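(* Let $D=D_1+D_0$ and $B$ be as in the context, with $\omega$ and $\beta$ the angle and constant of accretivity of $B$. There exist constants $\tau,C>0$, depending only on $\|D_0B\|$, $\|B\|$ and $\beta$, such that $\sigma(DB)\subset S_{\omega,\tau}$ and $$\|(\lambda-DB)^{-1}\|\le\frac{C}{\mathrm{dist}(\lambda,\overline S_{\omega})}\qquad\text{for all }\lambda\in\mathbb C\setminus S_{\omega,\tau},$$ where $\overline S_\omega=\{x+iy\in\mathbb C:|y|\le|x|\tan\omega\}$.
   Context: $\mathbf D(\cdot),\mathbf R(\cdot)$ denote domain and range; $\sigma,\rho$ spectrum and resolvent set. $\Omega\subset\mathbb R^n$ is a bounded weakly Lipschitz domain: a bounded open set such that, with $\Gamma=\partial\Omega$, $\Omega^+=\Omega$, $\Omega^-=\mathbb R^n\setminus\overline\Omega$, for each $y\in\Gamma$ there are a neighbourhood $V_y$ of $y$ and a bilipschitz map $\rho_y:\mathbb R^n\to\mathbb R^n$ with $\Omega^\pm\cap V_y=\rho_y(\mathbb R^n_\pm)\cap V_y$ and $\Gamma\cap V_y=\rho_y(\mathbb R^{n-1}\times\{0\})\cap V_y$, where $\mathbb R^n_\pm=\{x:\pm x_n>0\}$. $B\in L_\infty(\Omega;\mathbb C^{M\times M})$ is a pointwise strictly accretive multiplication operator on $L_2(\Omega;\mathbb C^M)$: $\beta:=\operatorname{ess\,inf}_x\inf_{v\ne0}\mathrm{Re}(B(x)v,v)/|v|^2>0$. $D$ is an (unbounded) operator in $L_2(\Omega;\mathbb C^M)$ with closed range such that: (1)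 $D=D_1+D_0$ with $D_0$ bounded on $L_2(\Omega;\mathbb C^M)$ and $D_1$ a self-adjoint homogeneous first-order differential operator with constant coefficients and local boundary conditions (i.e. $\mathbf D(D_1)$ is stable under multiplication by restrictions of smooth compactly supported scalar functions); (2) $(\lambda-D|_{\mathbf R(D)})^{-1}$ is compact for some, and therefore all, $\lambda\in\rho(D|_{\mathbf R(D)})$, where $D|_{\mathbf R(D)}$ is $D$ regarded as an operator in $\mathbf R(D)$ with domain $\mathbf D(D)\cap\mathbf R(D)$. $\omega:=\operatorname{ess\,sup}_{x}\sup_{v\ne0}|\arg(B(x)v,v)|<\pi/2$. For $\alpha\in[0,\pi/2)$ and $\tau\ge0$, $S_{\alpha,\tau}=\{x+iy\in\mathbb C:|y|<|x|\tan\alpha+\tau\}$. $DB$ is the operator in $L_2(\Omega;\mathbb C^M)$ with domain $\{u:Bu\in\mathbf D(D)\}$. *)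

theory Defs
  imports "HOL-Probability.Probability" "HOL-Library.Function_Algebras"
begin

text \<open>
  The dimensions \<open>n\<close> and \<open>M\<close> are natural numbers and not index types, so that constants
  independent of the dimensions can be expressed.  The space \<open>R\<^sup>n\<close> is the topological space
  \<^term>\<open>powertop_real {..<n}\<close>, whose points are the extensional functions on \<^term>\<open>{..<n}\<close>;
  coordinates are numbered from \<open>0\<close>, hence the last one is \<open>n - 1\<close>.  A vector of \<open>C\<^sup>M\<close> is a
  function of which only the values on \<^term>\<open>{..<M}\<close> matter.
\<close>

type_synonym point = "nat \<Rightarrow> real"
type_synonym cvec = "nat \<Rightarrow> complex"
type_synonym cmat = "nat \<Rightarrow> nat \<Rightarrow> complex"
type_synonym field = "point \<Rightarrow> cvec"
type_synonym operator = "(field \<times> field) set"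

abbreviation Rn :: "nat \<Rightarrow> point topology" where
  "Rn n \<equiv> powertop_real {..<n}"


section \<open>Weakly Lipschitz domains\<close>

definition eucl_dist :: "nat \<Rightarrow> point \<Rightarrow> point \<Rightarrow> real" where
  "eucl_dist n x y = L2_set (\<lambda>i. x i - y i) {..<n}"

definition bilipschitz :: "nat \<Rightarrow> (point \<Rightarrow> point) \<Rightarrow> bool" where
  "bilipschitz n \<rho> \<longleftrightarrow>
     \<rho> \<in> topspace (Rn n) \<rightarrow> topspace (Rn n) \<and>
     (\<exists>c>0. \<exists>L>0. \<forall>x\<in>topspace (Rn n). \<forall>y\<in>topspace (Rn n).
        c * eucl_dist n x y \<le> eucl_dist n (\<rho> x) (\<rho> y) \<and>
        eucl_dist n (\<rho> x) (\<rho> y) \<le> L * eucl_dist n x y)"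

definition weakly_lipschitz_domain :: "nat \<Rightarrow> point set \<Rightarrow> bool" where
  "weakly_lipschitz_domain n \<Omega> \<longleftrightarrow>
     openin (Rn n) \<Omega> \<and>
     (\<exists>r. \<forall>x\<in>\<Omega>. L2_set x {..<n} \<le> r) \<and>
     (\<forall>y\<in>Rn n frontier_of \<Omega>. \<exists>V \<rho>.
        openin (Rn n) V \<and> y \<in> V \<and> bilipschitz n \<rho> \<and>
        \<Omega> \<inter> V = \<rho> ` {x \<in> topspace (Rn n). x (n - 1) > 0} \<inter> V \<and>
        (topspace (Rn n) - Rn n closure_of \<Omega>) \<inter> V
          = \<rho> ` {x \<in> topspace (Rn n). x (n - 1) < 0} \<inter> V \<and>
        Rn n frontier_of \<Omega> \<inter> V = \<rho> ` {x \<in> topspace (Rn n). x (n - 1) = 0} \<inter> V)"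

definition lebesgue_dom :: "nat \<Rightarrow> point set \<Rightarrow> point measure" where
  "lebesgue_dom n \<Omega> = restrict_space (completion (Pi\<^sub>M {..<n} (\<lambda>_. lborel))) \<Omega>"


section \<open>The Hilbert space \<open>L\<^sub>2\<close>\<close>

text \<open>
  Elements of \<open>L\<^sub>2(\<mu>; C\<^sup>M)\<close> are represented by square integrable functions; equality of
  elements is \<open>ae_eq\<close>.
\<close>

definition ae_eq :: "point measure \<Rightarrow> nat \<Rightarrow> field \<Rightarrow> field \<Rightarrow> bool" where
  "ae_eq \<mu> M u v \<longleftrightarrow> (AE x in \<mu>. \<forall>i<M. u x i = v x i)"

definition L2 :: "point measure \<Rightarrow> nat \<Rightarrow> field set" where
  "L2 \<mu> M = {u. \<forall>i<M. (\<lambda>x. u x i) \<in> borel_measurable \<mu> \<and>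
                    integrable \<mu> (\<lambda>x. (cmod (u x i))\<^sup>2)}"

definition l2_inner :: "point measure \<Rightarrow> nat \<Rightarrow> field \<Rightarrow> field \<Rightarrow> complex" where
  "l2_inner \<mu> M u v = (LINT x|\<mu>. (\<Sum>i<M. u x i * cnj (v x i)))"

definition l2_norm :: "point measure \<Rightarrow> nat \<Rightarrow> field \<Rightarrow> real" where
  "l2_norm \<mu> M u = sqrt (LINT x|\<mu>. (\<Sum>i<M. (cmod (u x i))\<^sup>2))"

definition scale :: "complex \<Rightarrow> field \<Rightarrow> field" where
  "scale c u = (\<lambda>x i. c * u x i)"

definition l2_closed :: "point measure \<Rightarrow> nat \<Rightarrow> field set \<Rightarrow> bool" where
  "l2_closed \<mu> M S \<longleftrightarrow>
     (\<forall>f g. (\<forall>k::nat. f k \<in> S) \<longrightarrow> g \<in> L2 \<mu> M \<longrightarrow>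
        (\<lambda>k. l2_norm \<mu> M (f k - g)) \<longlonglongrightarrow> 0 \<longrightarrow> g \<in> S)"


section \<open>Unbounded operators\<close>

text \<open>
  An operator is given by its graph, so that its domain and range are \<^const>\<open>Domain\<close> and
  \<^const>\<open>Range\<close>.  Since the graph consists of representatives, it has to be closed under
  \<open>ae_eq\<close> in both components, and the value is unique up to \<open>ae_eq\<close>.  Here \<open>H\<close> is a subspace
  of \<open>L2 \<mu> M\<close> (either \<open>L2 \<mu> M\<close> or the range of \<open>D\<close> below).
\<close>

definition operator_in :: "point measure \<Rightarrow> nat \<Rightarrow> field set \<Rightarrow> operator \<Rightarrow> bool" where
  "operator_in \<mu> M H T \<longleftrightarrow>
     T \<subseteq> H \<times> H \<and>
     (0, 0) \<in> T \<and>
     (\<forall>u f v g. (u, f) \<in> T \<longrightarrow> (v, g) \<in> T \<longrightarrow> (u + v, f + g) \<in> T) \<and>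
     (\<forall>c u f. (u, f) \<in> T \<longrightarrow> (scale c u, scale c f) \<in> T) \<and>
     (\<forall>u f v g. (u, f) \<in> T \<longrightarrow> v \<in> H \<longrightarrow> g \<in> H \<longrightarrow> ae_eq \<mu> M u v \<longrightarrow> ae_eq \<mu> M f g
        \<longrightarrow> (v, g) \<in> T) \<and>
     (\<forall>u f g. (u, f) \<in> T \<longrightarrow> (u, g) \<in> T \<longrightarrow> ae_eq \<mu> M f g)"

definition bounded_operator :: "point measure \<Rightarrow> nat \<Rightarrow> field set \<Rightarrow> operator \<Rightarrow> bool" where
  "bounded_operator \<mu> M H T \<longleftrightarrow>
     operator_in \<mu> M H T \<and> Domain T = H \<and>
     (\<exists>K. \<forall>(u, f)\<in>T. l2_norm \<mu> M f \<le> K * l2_norm \<mu> M u)"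

definition op_norm :: "point measure \<Rightarrow> nat \<Rightarrow> operator \<Rightarrow> real" where
  "op_norm \<mu> M T = Sup {l2_norm \<mu> M f | u f. (u, f) \<in> T \<and> l2_norm \<mu> M u \<le> 1}"

definition compact_operator :: "point measure \<Rightarrow> nat \<Rightarrow> field set \<Rightarrow> operator \<Rightarrow> bool" where
  "compact_operator \<mu> M H T \<longleftrightarrow>
     bounded_operator \<mu> M H T \<and>
     (\<forall>g u. (\<forall>k::nat. (g k, u k) \<in> T) \<longrightarrow> (\<exists>K. \<forall>k. l2_norm \<mu> M (g k) \<le> K) \<longrightarrow>
        (\<exists>r v. strict_mono r \<and> v \<in> H \<and> (\<lambda>k. l2_norm \<mu> M (u (r k) - v)) \<longlonglongrightarrow> 0))"

definition op_add :: "operator \<Rightarrow> operator \<Rightarrow> operator" where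
  "op_add S T = {(u, f + g) | u f g. (u, f) \<in> S \<and> (u, g) \<in> T}"

text \<open>The inverse relation \<open>(\<lambda> - T)\<^sup>-\<^sup>1\<close>, which need not be single-valued in general.\<close>

definition resolvent :: "complex \<Rightarrow> operator \<Rightarrow> operator" where
  "resolvent l T = {(scale l u - f, u) | u f. (u, f) \<in> T}"

definition resolvent_set :: "point measure \<Rightarrow> nat \<Rightarrow> field set \<Rightarrow> operator \<Rightarrow> complex set" where
  "resolvent_set \<mu> M H T = {l. bounded_operator \<mu> M H (resolvent l T)}"

definition spectrum :: "point measure \<Rightarrow> nat \<Rightarrow> field set \<Rightarrow> operator \<Rightarrow> complex set" where
  "spectrum \<mu> M H T = - resolvent_set \<mu> M H T"

definition adjoint_op :: "point measure \<Rightarrow> nat \<Rightarrow> operator \<Rightarrow> operator" where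
  "adjoint_op \<mu> M T = {(v, g). v \<in> L2 \<mu> M \<and> g \<in> L2 \<mu> M \<and>
     (\<forall>(u, f)\<in>T. l2_inner \<mu> M f v = l2_inner \<mu> M u g)}"

definition self_adjoint :: "point measure \<Rightarrow> nat \<Rightarrow> operator \<Rightarrow> bool" where
  "self_adjoint \<mu> M T \<longleftrightarrow>
     operator_in \<mu> M (L2 \<mu> M) T \<and>
     (\<forall>u\<in>L2 \<mu> M. \<forall>e>0. \<exists>v\<in>Domain T. l2_norm \<mu> M (u - v) < e) \<and>
     adjoint_op \<mu> M T = T"

definition restrict_to_range :: "operator \<Rightarrow> operator" where
  "restrict_to_range T = {(u, f) \<in> T. u \<in> Range T}"


section \<open>Differential operators\<close>

definition partial :: "nat \<Rightarrow> (point \<Rightarrow> complex) \<Rightarrow> point \<Rightarrow> complex" where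
  "partial j \<phi> x = vector_derivative (\<lambda>t. \<phi> (x(j := t))) (at (x j))"

primrec C_k :: "nat \<Rightarrow> nat \<Rightarrow> (point \<Rightarrow> complex) \<Rightarrow> bool" where
  "C_k n 0 \<phi> \<longleftrightarrow> continuous_map (Rn n) euclidean \<phi>"
| "C_k n (Suc k) \<phi> \<longleftrightarrow>
     continuous_map (Rn n) euclidean \<phi> \<and>
     (\<forall>j<n. (\<forall>x\<in>topspace (Rn n). (\<lambda>t. \<phi> (x(j := t))) differentiable at (x j)) \<and>
            C_k n k (partial j \<phi>))"

text \<open>Smooth functions on \<open>R\<^sup>n\<close> with compact support contained in \<open>U\<close>.\<close>

definition test_functions :: "nat \<Rightarrow> point set \<Rightarrow> (point \<Rightarrow> complex) set" where
  "test_functions n U = {\<phi>. (\<forall>k. C_k n k \<phi>) \<and>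
     (\<exists>K. compactin (Rn n) K \<and> K \<subseteq> U \<and> (\<forall>x\<in>topspace (Rn n) - K. \<phi> x = 0))}"

text \<open>
  \<open>T\<close> acts as \<open>\<Sum>\<^sub>j A\<^sub>j \<partial>\<^sub>j\<close> in the sense of distributions on \<open>\<Omega>\<close>, with constant matrices \<open>A\<^sub>j\<close>
  and no term of order zero.  The domain of \<open>T\<close> is not prescribed.
\<close>

definition homogeneous_first_order :: "nat \<Rightarrow> nat \<Rightarrow> point set \<Rightarrow> operator \<Rightarrow> bool" where
  "homogeneous_first_order n M \<Omega> T \<longleftrightarrow>
     (\<exists>A :: nat \<Rightarrow> cmat. \<forall>(u, f)\<in>T. \<forall>\<phi>\<in>test_functions n \<Omega>. \<forall>i<M.
        (LINT x|lebesgue_dom n \<Omega>. f x i * \<phi> x) =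
        - (\<Sum>j<n. \<Sum>k<M. A j i k * (LINT x|lebesgue_dom n \<Omega>. u x k * partial j \<phi> x)))"

definition local_boundary_conditions :: "nat \<Rightarrow> operator \<Rightarrow> bool" where
  "local_boundary_conditions n T \<longleftrightarrow>
     (\<forall>\<eta>\<in>test_functions n (topspace (Rn n)). \<forall>u\<in>Domain T. (\<lambda>x i. \<eta> x * u x i) \<in> Domain T)"


section \<open>Accretive multiplication operators\<close>

definition L_infty_matrix :: "point measure \<Rightarrow> nat \<Rightarrow> (point \<Rightarrow> cmat) \<Rightarrow> bool" where
  "L_infty_matrix \<mu> M B \<longleftrightarrow>
     (\<forall>i<M. \<forall>j<M. (\<lambda>x. B x i j) \<in> borel_measurable \<mu> \<and> (\<exists>K. AE x in \<mu>. cmod (B x i j) \<le> K))"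

definition mult_op :: "point measure \<Rightarrow> nat \<Rightarrow> (point \<Rightarrow> cmat) \<Rightarrow> operator" where
  "mult_op \<mu> M B = {(u, f). u \<in> L2 \<mu> M \<and> f \<in> L2 \<mu> M \<and>
     ae_eq \<mu> M f (\<lambda>x i. \<Sum>j<M. B x i j * u x j)}"

definition sesq :: "nat \<Rightarrow> cmat \<Rightarrow> cvec \<Rightarrow> complex" where
  "sesq M A v = (\<Sum>i<M. (\<Sum>j<M. A i j * v j) * cnj (v i))"

definition nonzero_vecs :: "nat \<Rightarrow> cvec set" where
  "nonzero_vecs M = {v. \<exists>i<M. v i \<noteq> 0}"

text \<open>The essential infimum of \<open>g\<close> is expressed as \<open>- esssup (- g)\<close>.\<close>

definition accretivity_const :: "point measure \<Rightarrow> nat \<Rightarrow> (point \<Rightarrow> cmat) \<Rightarrow> ereal" where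
  "accretivity_const \<mu> M B =
     - esssup \<mu> (\<lambda>x. - (INF v\<in>nonzero_vecs M.
         ereal (Re (sesq M (B x) v) / (\<Sum>i<M. (cmod (v i))\<^sup>2))))"

definition accretivity_angle :: "point measure \<Rightarrow> nat \<Rightarrow> (point \<Rightarrow> cmat) \<Rightarrow> ereal" where
  "accretivity_angle \<mu> M B =
     esssup \<mu> (\<lambda>x. SUP v\<in>nonzero_vecs M. ereal \<bar>Arg (sesq M (B x) v)\<bar>)"


section \<open>Sectors\<close>

definition sector :: "real \<Rightarrow> real \<Rightarrow> complex set" where
  "sector \<alpha> \<tau> = {z. \<bar>Im z\<bar> < \<bar>Re z\<bar> * tan \<alpha> + \<tau>}"

definition closed_sector :: "real \<Rightarrow> complex set" where
  "closed_sector \<alpha> = {z. \<bar>Im z\<bar> \<le> \<bar>Re z\<bar> * tan \<alpha>}"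

end

theory Submission
  imports Defs
begin

text \<open>
  For \<open>(\<lambda> - DB)u = f\<close>, pairing with \<open>Bu\<close> removes \<open>(D\<^sub>1 Bu, Bu)\<close>, which is real, so
  \<open>Im \<lambda>(u, Bu) = Im (f + D\<^sub>0 Bu, Bu)\<close>.  As \<open>(Bu, u)\<close> lies in the sector of angle \<open>\<omega>\<close>, the left-hand side
  has modulus at least \<open>\<delta> \<beta> \<parallel>u\<parallel>\<^sup>2\<close> with \<open>\<delta> = |Im \<lambda>| - |Re \<lambda>| tan \<omega> \<ge> dist(\<lambda>, S\<^sub>\<omega>)\<close>.  If
  \<open>\<delta> \<beta> \<ge> 2 \<parallel>D\<^sub>0 B\<parallel> \<parallel>B\<parallel>\<close>, the term with \<open>D\<^sub>0\<close> is absorbed and \<open>\<parallel>u\<parallel> \<le> 2 \<parallel>B\<parallel> \<parallel>f\<parallel> / (\<delta> \<beta>)\<close>.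
  Surjectivity of \<open>\<lambda> - DB\<close> is obtained from that of \<open>\<i> s - D\<^sub>1\<close> for real \<open>s \<noteq> 0\<close> by a contraction
  argument.
\<close>

section \<open>Complete semi-inner product spaces\<close>

text \<open>The unknown of the equation is \<open>w = B u\<close> rather than \<open>u\<close>: then
  \<open>D1\<close> acts on the unknown itself, and its self-adjointness applies unchanged. The
  price is that \<open>B\<close> must be onto, which follows from its accretivity. The contraction
  needs the bounded part \<open>A\<close>, given by \<open>A w = l u - D0 w\<close>, to satisfy that
  \<open>\<i> s - A\<close> has norm below \<open>\<bar>s\<bar>\<close>. If \<open>A\<close> has
  norm at most \<alpha> and signed imaginary part at least \<gamma>, the squared norm is at most
  \<open>s^2 - 2 s \<gamma> + \<alpha>^2\<close>. So the coercivity behind the estimate also yields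
  surjectivity. Absorbing \<open>D0\<close> spends half of that coercivity, whence the factor 2 in
  both constants. Elements of \<open>L2\<close> are functions and not classes. The abstract part
  therefore works with a possibly degenerate form on a carrier \<open>V\<close>, operators are
  relations, and equations are solved up to vectors of norm zero. Closure of the graphs under such
  changes makes the solutions exact at the end.\<close>

locale semi_inner = vector_space smult
  for smult :: "complex \<Rightarrow> 'a::ab_group_add \<Rightarrow> 'a" (infixr \<open>\<odot>\<close> 75) +
  fixes V :: "'a set" and ip :: "'a \<Rightarrow> 'a \<Rightarrow> complex"
  assumes subspace_V: "subspace V"
    and ip_add_left: "\<lbrakk>x \<in> V; y \<in> V; z \<in> V\<rbrakk> \<Longrightarrow> ip (x + y) z = ip x z + ip y z"
    and ip_scale_left: "\<lbrakk>x \<in> V; y \<in> V\<rbrakk> \<Longrightarrow> ip (c \<odot> x) y = c * ip x y"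
    and ip_commute: "\<lbrakk>x \<in> V; y \<in> V\<rbrakk> \<Longrightarrow> ip y x = cnj (ip x y)"
    and ip_self_nonneg: "x \<in> V \<Longrightarrow> 0 \<le> Re (ip x x)"
begin

definition nrm :: "'a \<Rightarrow> real" where
  "nrm x = sqrt (Re (ip x x))"

definition lin_rel :: "('a \<times> 'a) set \<Rightarrow> bool" where
  "lin_rel T \<longleftrightarrow> T \<subseteq> V \<times> V \<and> (0, 0) \<in> T \<and>
     (\<forall>u f v g. (u, f) \<in> T \<longrightarrow> (v, g) \<in> T \<longrightarrow> (u + v, f + g) \<in> T) \<and>
     (\<forall>c u f. (u, f) \<in> T \<longrightarrow> (c \<odot> u, c \<odot> f) \<in> T)"

definition symmetric_rel :: "('a \<times> 'a) set \<Rightarrow> bool" where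
  "symmetric_rel T \<longleftrightarrow> (\<forall>(u, f)\<in>T. \<forall>(v, g)\<in>T. ip f v = ip u g)"

definition adj :: "('a \<times> 'a) set \<Rightarrow> ('a \<times> 'a) set" where
  "adj T = {(v, g). v \<in> V \<and> g \<in> V \<and> (\<forall>(u, f)\<in>T. ip f v = ip u g)}"

section \<open>Norm, Cauchy-Schwarz and triangle inequality for a degenerate form\<close>

lemma V_0 [simp, intro]: "0 \<in> V"
  and V_add [simp, intro]: "\<lbrakk>x \<in> V; y \<in> V\<rbrakk> \<Longrightarrow> x + y \<in> V"
  and V_scale [simp, intro]: "x \<in> V \<Longrightarrow> c \<odot> x \<in> V"
  and V_diff [simp, intro]: "\<lbrakk>x \<in> V; y \<in> V\<rbrakk> \<Longrightarrow> x - y \<in> V"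
  using subspace_V by (auto simp: subspace_0 subspace_add subspace_scale subspace_diff)

lemma ip_diff_left: "\<lbrakk>x \<in> V; y \<in> V; z \<in> V\<rbrakk> \<Longrightarrow> ip (x - y) z = ip x z - ip y z"
  using ip_add_left[of "x - y" y z] by simp

lemma ip_add_right: "\<lbrakk>x \<in> V; y \<in> V; z \<in> V\<rbrakk> \<Longrightarrow> ip z (x + y) = ip z x + ip z y"
  using ip_commute[of "x + y" z] ip_commute[of x z] ip_commute[of y z] by (simp add: ip_add_left)

lemma ip_diff_right: "\<lbrakk>x \<in> V; y \<in> V; z \<in> V\<rbrakk> \<Longrightarrow> ip z (x - y) = ip z x - ip z y"
  using ip_add_right[of "x - y" y z] by simp

lemma ip_scale_right: "\<lbrakk>x \<in> V; y \<in> V\<rbrakk> \<Longrightarrow> ip y (c \<odot> x) = cnj c * ip y x"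
  using ip_commute[of "c \<odot> x" y] ip_commute[of x y] by (simp add: ip_scale_left)

lemma Im_ip_self: "x \<in> V \<Longrightarrow> Im (ip x x) = 0"
  using ip_commute[of x x] by (simp add: complex_eq_iff)

lemma nrm_nonneg: "x \<in> V \<Longrightarrow> 0 \<le> nrm x"
  by (simp add: nrm_def ip_self_nonneg)

lemma nrm_sq: "x \<in> V \<Longrightarrow> (nrm x)\<^sup>2 = Re (ip x x)"
  by (simp add: nrm_def ip_self_nonneg)

lemma ip_self: "x \<in> V \<Longrightarrow> ip x x = complex_of_real ((nrm x)\<^sup>2)"
  by (simp add: complex_eq_iff nrm_sq Im_ip_self)

lemma nrm_scale: "x \<in> V \<Longrightarrow> nrm (c \<odot> x) = cmod c * nrm x"
proof -
  assume x: "x \<in> V"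
  have "ip (c \<odot> x) (c \<odot> x) = (c * cnj c) * ip x x"
    using x by (simp add: ip_scale_left ip_scale_right)
  also have "\<dots> = complex_of_real ((cmod c * nrm x)\<^sup>2)"
    unfolding ip_self[OF x] complex_norm_square[symmetric]
    by (simp only: of_real_mult of_real_power power_mult_distrib)
  finally have "ip (c \<odot> x) (c \<odot> x) = complex_of_real ((cmod c * nrm x)\<^sup>2)" .
  then have "(nrm (c \<odot> x))\<^sup>2 = (cmod c * nrm x)\<^sup>2"
    using x nrm_sq[of "c \<odot> x"] by simp
  then show ?thesis
    using x by (simp add: nrm_nonneg power2_eq_iff_nonneg)
qed

lemma nrm_add_sq:
  "\<lbrakk>x \<in> V; y \<in> V\<rbrakk> \<Longrightarrow> (nrm (x + y))\<^sup>2 = (nrm x)\<^sup>2 + 2 * Re (ip x y) + (nrm y)\<^sup>2"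
  using ip_commute[of x y] by (simp add: nrm_sq ip_add_left ip_add_right)

lemma nrm_diff_sq:
  "\<lbrakk>x \<in> V; y \<in> V\<rbrakk> \<Longrightarrow> (nrm (x - y))\<^sup>2 = (nrm x)\<^sup>2 - 2 * Re (ip x y) + (nrm y)\<^sup>2"
  using ip_commute[of x y] by (simp add: nrm_sq ip_diff_left ip_diff_right)

text \<open>The coefficient \<open>t * ip x y\<close> makes the cross term real, which leaves a real
  quadratic in \<open>t\<close>. Its nonnegativity gives the Cauchy-Schwarz inequality; its
  minimality at \<open>t = 0\<close> gives the orthogonality of the residual of a
  projection.\<close>

lemma nrm_diff_scale_sq:
  assumes "x \<in> V" "y \<in> V"
  shows "(nrm (x - (complex_of_real t * ip x y) \<odot> y))\<^sup>2
    = (nrm x)\<^sup>2 - 2 * t * (cmod (ip x y))\<^sup>2 + t\<^sup>2 * (cmod (ip x y))\<^sup>2 * (nrm y)\<^sup>2"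
proof -
  have "ip x ((complex_of_real t * ip x y) \<odot> y) = complex_of_real (t * (cmod (ip x y))\<^sup>2)"
    using assms complex_norm_square[of "ip x y"] by (simp add: ip_scale_right mult_ac)
  then show ?thesis
    using assms by (simp add: nrm_diff_sq nrm_scale norm_mult power_mult_distrib)
qed

lemma Cauchy_Schwarz:
  assumes "x \<in> V" "y \<in> V"
  shows "cmod (ip x y) \<le> nrm x * nrm y"
proof -
  define p a b where "p = (cmod (ip x y))\<^sup>2" and "a = (nrm x)\<^sup>2" and "b = (nrm y)\<^sup>2"
  have q: "0 \<le> a - 2 * t * p + t\<^sup>2 * p * b" for t
    using nrm_diff_scale_sq[OF assms, of t] unfolding p_def a_def b_def
    by (metis zero_le_power2)
  have "p \<le> a * b"
  proof (cases "b = 0")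
    case True
    \<comment> \<open>A vector \<open>y\<close> of norm zero need not be \<open>0\<close>. The
      quadratic is then affine in \<open>t\<close>, and a nonzero slope would let it take the value
      -1.\<close>
    have "p = 0"
    proof (rule ccontr)
      assume "p \<noteq> 0"
      then have "a - 2 * ((a + 1) / (2 * p)) * p = -1"
        by (simp add: field_simps)
      then show False
        using q[of "(a + 1) / (2 * p)"] True by simp
    qed
    then show ?thesis using True by simp
  next
    case False
    then have b: "b > 0" by (simp add: b_def)
    have "0 \<le> a - p / b"
      using q[of "1 / b"] b by (simp add: power2_eq_square)
    then show ?thesis using b by (simp add: field_simps)
  qed
  then have "(cmod (ip x y))\<^sup>2 \<le> (nrm x * nrm y)\<^sup>2"
    by (simp add: p_def a_def b_def power_mult_distrib)
  then show ?thesis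
    using assms by (simp add: nrm_nonneg power2_le_iff_abs_le)
qed

lemma nrm_triangle: "\<lbrakk>x \<in> V; y \<in> V\<rbrakk> \<Longrightarrow> nrm (x + y) \<le> nrm x + nrm y"
proof -
  assume xy: "x \<in> V" "y \<in> V"
  have "(nrm (x + y))\<^sup>2 \<le> (nrm x + nrm y)\<^sup>2"
    using xy Cauchy_Schwarz[OF xy] complex_Re_le_cmod[of "ip x y"]
    by (simp add: nrm_add_sq power2_sum)
  then show ?thesis
    using xy by (simp add: nrm_nonneg power2_le_iff_abs_le)
qed

lemma nrm_zero [simp]: "nrm 0 = 0"
  using nrm_scale[of 0 0] by simp

lemma nrm_minus: "x \<in> V \<Longrightarrow> nrm (- x) = nrm x"
  using nrm_scale[of x "-1"] by simp

lemma nrm_diff_commute: "\<lbrakk>x \<in> V; y \<in> V\<rbrakk> \<Longrightarrow> nrm (x - y) = nrm (y - x)"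
  using nrm_minus[of "x - y"] by simp

lemma nrm_diff_triangle:
  "\<lbrakk>x \<in> V; y \<in> V; z \<in> V\<rbrakk> \<Longrightarrow> nrm (x - z) \<le> nrm (x - y) + nrm (y - z)"
  using nrm_triangle[of "x - y" "y - z"] by simp

lemma nrm_diff_le: "\<lbrakk>x \<in> V; y \<in> V\<rbrakk> \<Longrightarrow> nrm (x - y) \<le> nrm x + nrm y"
  using nrm_diff_triangle[of x 0 y] nrm_minus[of y] by simp

lemma nrm_le_add_diff: "\<lbrakk>x \<in> V; y \<in> V\<rbrakk> \<Longrightarrow> nrm x \<le> nrm y + nrm (x - y)"
  using nrm_triangle[of y "x - y"] by simp

text \<open>By Cauchy-Schwarz a vector of norm zero is orthogonal to all of \<open>V\<close>, so a
  change of representative does not affect an inner product.\<close>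

lemma ip_cong_right:
  assumes "x \<in> V" "y \<in> V" "z \<in> V" "nrm (x - y) = 0"
  shows "ip z x = ip z y"
  using Cauchy_Schwarz[of z "x - y"] assms by (simp add: ip_diff_right)

lemma nrm_cong:
  assumes "x \<in> V" "y \<in> V" "nrm (x - y) = 0"
  shows "nrm x = nrm y"
  using nrm_le_add_diff[of x y] nrm_le_add_diff[of y x] nrm_diff_commute[of x y] assms by simp

section \<open>Limits with respect to the seminorm\<close>

lemma tendsto_ip_left:
  assumes "\<And>k. X k \<in> V" "x \<in> V" "z \<in> V" "(\<lambda>k. nrm (X k - x)) \<longlonglongrightarrow> 0"
  shows "(\<lambda>k. ip (X k) z) \<longlonglongrightarrow> ip x z"
proof -
  have "(\<lambda>k. ip (X k) z - ip x z) \<longlonglongrightarrow> 0"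
  proof (rule Lim_null_comparison)
    show "\<forall>\<^sub>F k in sequentially. norm (ip (X k) z - ip x z) \<le> nrm (X k - x) * nrm z"
      using Cauchy_Schwarz[of "X _ - x" z] assms(1-3) by (simp add: ip_diff_left)
    show "(\<lambda>k. nrm (X k - x) * nrm z) \<longlonglongrightarrow> 0"
      using tendsto_mult_left_zero[OF assms(4)] by simp
  qed
  then show ?thesis by (rule LIM_zero_cancel)
qed

lemma tendsto_ip_right:
  assumes "\<And>k. X k \<in> V" "x \<in> V" "z \<in> V" "(\<lambda>k. nrm (X k - x)) \<longlonglongrightarrow> 0"
  shows "(\<lambda>k. ip z (X k)) \<longlonglongrightarrow> ip z x"
  using tendsto_cnj[OF tendsto_ip_left[OF assms]] assms(1-3) ip_commute[of _ z] by simp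

lemma tendsto_nrm:
  assumes "\<And>k. X k \<in> V" "x \<in> V" "(\<lambda>k. nrm (X k - x)) \<longlonglongrightarrow> 0"
  shows "(\<lambda>k. nrm (X k)) \<longlonglongrightarrow> nrm x"
proof -
  have "(\<lambda>k. nrm (X k) - nrm x) \<longlonglongrightarrow> 0"
  proof (rule Lim_null_comparison)
    show "\<forall>\<^sub>F k in sequentially. norm (nrm (X k) - nrm x) \<le> nrm (X k - x)"
    proof (rule always_eventually, rule allI)
      fix k
      show "norm (nrm (X k) - nrm x) \<le> nrm (X k - x)"
        using nrm_le_add_diff[of x "X k"] nrm_le_add_diff[of "X k" x] nrm_diff_commute[of "X k" x]
          assms(1)[of k] assms(2) by auto
    qed
  qed (rule assms(3))
  then show ?thesis by (rule LIM_zero_cancel)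
qed

lemma tendsto_nrm_diff:
  assumes "\<And>k. X k \<in> V" "x \<in> V" "y \<in> V" "(\<lambda>k. nrm (X k - x)) \<longlonglongrightarrow> 0"
  shows "(\<lambda>k. nrm (X k - y)) \<longlonglongrightarrow> nrm (x - y)"
  using tendsto_nrm[of "\<lambda>k. X k - y" "x - y"] assms by simp

section \<open>Linear relations, symmetry and adjoints\<close>

lemma lin_relD:
  assumes "lin_rel T"
  shows lin_rel_V: "(u, f) \<in> T \<Longrightarrow> u \<in> V" "(u, f) \<in> T \<Longrightarrow> f \<in> V"
    and lin_rel_0: "(0, 0) \<in> T"
    and lin_rel_add: "\<lbrakk>(u, f) \<in> T; (v, g) \<in> T\<rbrakk> \<Longrightarrow> (u + v, f + g) \<in> T"
    and lin_rel_scale: "(u, f) \<in> T \<Longrightarrow> (c \<odot> u, c \<odot> f) \<in> T"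
  using assms unfolding lin_rel_def by blast+

lemma lin_rel_diff:
  assumes "lin_rel T" "(u, f) \<in> T" "(v, g) \<in> T"
  shows "(u - v, f - g) \<in> T"
  using lin_rel_add[OF assms(1,2) lin_rel_scale[OF assms(1,3), of "-1"]] by simp

lemma self_adjoint_symmetric: "adj T = T \<Longrightarrow> symmetric_rel T"
  unfolding adj_def symmetric_rel_def by blast

lemma symmetric_rel_Im:
  assumes "lin_rel T" "symmetric_rel T" "(u, f) \<in> T"
  shows "Im (ip f u) = 0"
proof -
  have "ip f u = ip u f"
    using assms(2,3) unfolding symmetric_rel_def by blast
  also have "\<dots> = cnj (ip f u)"
    using assms(1,3) lin_rel_V by (intro ip_commute) blast+
  finally show ?thesis by (simp add: complex_eq_iff)
qed

text \<open>Pythagoras: the real part of the inner product of \<open>\<i> s w\<close> and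
  \<open>h\<close> is \<open>s * Im (ip h w)\<close>, which symmetry makes zero.\<close>

lemma symmetric_rel_lower_bound:
  assumes "lin_rel T" "symmetric_rel T" "(w, h) \<in> T"
  shows "\<bar>s\<bar> * nrm w \<le> nrm ((\<i> * complex_of_real s) \<odot> w - h)"
proof -
  have V: "w \<in> V" "h \<in> V" using lin_rel_V assms by blast+
  have "Re (ip ((\<i> * complex_of_real s) \<odot> w) h) = s * Im (ip h w)"
    using V ip_commute[of h w] by (simp add: ip_scale_left)
  then have "(nrm ((\<i> * complex_of_real s) \<odot> w - h))\<^sup>2 = (\<bar>s\<bar> * nrm w)\<^sup>2 + (nrm h)\<^sup>2"
    using V symmetric_rel_Im[OF assms] by (simp add: nrm_diff_sq nrm_scale norm_mult)
  then have "(\<bar>s\<bar> * nrm w)\<^sup>2 \<le> (nrm ((\<i> * complex_of_real s) \<odot> w - h))\<^sup>2" by simp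
  then show ?thesis by (rule power2_le_imp_le) (simp add: V nrm_nonneg)
qed

text \<open>Membership in \<open>adj T\<close> is a family of equations, one for each pair in
  \<open>T\<close>, and each passes to the limit. A self-adjoint relation thereby inherits
  closedness.\<close>

lemma adj_closed:
  assumes T: "T \<subseteq> V \<times> V"
    and X: "\<And>k. (X k, Y k) \<in> adj T" and "x \<in> V" "y \<in> V"
    and "(\<lambda>k. nrm (X k - x)) \<longlonglongrightarrow> 0" "(\<lambda>k. nrm (Y k - y)) \<longlonglongrightarrow> 0"
  shows "(x, y) \<in> adj T"
proof -
  have XY: "X k \<in> V" "Y k \<in> V" for k using X[of k] by (auto simp: adj_def)
  have "ip f x = ip u y" if "(u, f) \<in> T" for u f
  proof (rule LIMSEQ_unique)
    have uf: "u \<in> V" "f \<in> V" using that T by auto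
    show "(\<lambda>k. ip f (X k)) \<longlonglongrightarrow> ip f x"
      using XY assms uf by (intro tendsto_ip_right)
    have "ip f (X k) = ip u (Y k)" for k
      using X[of k] that by (auto simp: adj_def)
    then show "(\<lambda>k. ip f (X k)) \<longlonglongrightarrow> ip u y"
      using tendsto_ip_right[of Y y u] XY assms uf by simp
  qed
  then show ?thesis using assms by (auto simp: adj_def)
qed

end


text \<open>Cauchy sequences carry an explicit modulus \<open>e\<close>, because every application
  produces one. A limit is determined only up to a vector of norm zero.\<close>

locale semi_hilbert = semi_inner +
  assumes complete:
    "\<And>X e. \<lbrakk>\<And>k. X k \<in> V; \<And>m n. n \<le> m \<Longrightarrow> nrm (X m - X n) \<le> e n; e \<longlonglongrightarrow> 0\<rbrakk>
       \<Longrightarrow> \<exists>x\<in>V. (\<lambda>k. nrm (X k - x)) \<longlonglongrightarrow> 0"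
begin

text \<open>Banach's theorem for a relation. Two values of \<open>G\<close> at the same point differ
  by a vector of norm zero (take \<open>x = y\<close> in \<open>contr\<close>), so any selection
  \<open>\<Phi>\<close> may be iterated, and the fixed point is exact only modulo such
  vectors.\<close>

lemma contraction_fixed_point:
  assumes G: "G \<subseteq> V \<times> V" "Domain G = V" and q: "0 \<le> q" "q < 1"
    and contr: "\<And>x x' y y'. \<lbrakk>(x, x') \<in> G; (y, y') \<in> G\<rbrakk> \<Longrightarrow> nrm (x' - y') \<le> q * nrm (x - y)"
  shows "\<exists>w w'. (w, w') \<in> G \<and> nrm (w' - w) = 0"
proof -
  obtain \<Phi> where \<Phi>: "\<And>x. x \<in> V \<Longrightarrow> (x, \<Phi> x) \<in> G"
  proof -
    have "\<forall>x\<in>V. \<exists>x'. (x, x') \<in> G" using G(2) by blast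
    from bchoice[OF this] show ?thesis using that by blast
  qed
  have \<Phi>V: "\<Phi> x \<in> V" if "x \<in> V" for x using \<Phi>[OF that] G(1) by auto
  define X where "X k = (\<Phi> ^^ k) 0" for k
  have XV: "X k \<in> V" for k by (induction k) (simp_all add: X_def \<Phi>V)
  have XS: "X (Suc k) = \<Phi> (X k)" for k by (simp add: X_def)
  define d where "d = nrm (X 1 - X 0)"
  have d0: "d \<ge> 0" by (simp add: d_def XV nrm_nonneg)
  have step: "nrm (X (Suc k) - X k) \<le> q ^ k * d" for k
  proof (induction k)
    case 0 then show ?case by (simp add: d_def)
  next
    case (Suc k)
    have "nrm (X (Suc (Suc k)) - X (Suc k)) \<le> q * nrm (X (Suc k) - X k)"
      unfolding XS[of "Suc k"] XS[of k] by (rule contr) (auto intro!: \<Phi> \<Phi>V XV)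
    also have "\<dots> \<le> q * (q ^ k * d)" using Suc q by (intro mult_left_mono)
    finally show ?case by simp
  qed
  \<comment> \<open>The closed form of the geometric sum makes the induction on \<open>j\<close> go
    through; dropping \<open>q ^ j\<close> afterwards leaves a bound in \<open>n\<close>
    alone.\<close>
  have bd: "nrm (X (n + j) - X n) \<le> q ^ n * d * (1 - q ^ j) / (1 - q)" for n j
  proof (induction j)
    case 0 then show ?case by simp
  next
    case (Suc j)
    have "nrm (X (n + Suc j) - X n) \<le> nrm (X (Suc (n + j)) - X (n + j)) + nrm (X (n + j) - X n)"
      using nrm_diff_triangle[OF XV XV XV] by simp
    also have "\<dots> \<le> q ^ (n + j) * d + q ^ n * d * (1 - q ^ j) / (1 - q)"
      using step[of "n + j"] Suc by (intro add_mono) auto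
    also have "\<dots> = q ^ n * d * (1 - q ^ Suc j) / (1 - q)"
      using q by (simp add: field_simps power_add)
    finally show ?case .
  qed
  have "\<exists>x\<in>V. (\<lambda>k. nrm (X k - x)) \<longlonglongrightarrow> 0"
  proof (rule complete)
    fix m n :: nat assume "n \<le> m"
    then obtain j where m: "m = n + j" using le_Suc_ex by blast
    have "nrm (X m - X n) \<le> q ^ n * d * (1 - q ^ j) / (1 - q)" using bd m by simp
    also have "\<dots> \<le> q ^ n * d * 1 / (1 - q)"
      using q d0 by (intro divide_right_mono mult_left_mono) auto
    finally show "nrm (X m - X n) \<le> q ^ n * (d / (1 - q))" by simp
  next
    show "(\<lambda>n. q ^ n * (d / (1 - q))) \<longlonglongrightarrow> 0"
      using q by (intro tendsto_mult_left_zero LIMSEQ_realpow_zero)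
  qed (rule XV)
  then obtain w where w: "w \<in> V" "(\<lambda>k. nrm (X k - w)) \<longlonglongrightarrow> 0" by blast
  have "nrm (\<Phi> w - w) \<le> 0"
  proof (rule tendsto_lowerbound)
    show "(\<lambda>k. q * nrm (X k - w) + nrm (X (Suc k) - w)) \<longlonglongrightarrow> 0"
      using tendsto_add[OF tendsto_mult_right_zero[OF w(2)] LIMSEQ_Suc[OF w(2)]] by simp
    show "\<forall>\<^sub>F k in sequentially. nrm (\<Phi> w - w) \<le> q * nrm (X k - w) + nrm (X (Suc k) - w)"
    proof (rule always_eventually, rule allI)
      fix k
      have "nrm (\<Phi> w - w) \<le> nrm (X (Suc k) - \<Phi> w) + nrm (X (Suc k) - w)"
        using nrm_diff_triangle[of "\<Phi> w" "X (Suc k)" w] nrm_diff_commute[of "\<Phi> w" "X (Suc k)"]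
          XV w \<Phi>V by simp
      moreover have "nrm (X (Suc k) - \<Phi> w) \<le> q * nrm (X k - w)"
        unfolding XS by (rule contr) (auto intro!: \<Phi> XV w)
      ultimately show "nrm (\<Phi> w - w) \<le> q * nrm (X k - w) + nrm (X (Suc k) - w)" by simp
    qed
  qed simp
  then have "nrm (\<Phi> w - w) = 0" using nrm_nonneg[of "\<Phi> w - w"] w \<Phi>V by simp
  then show ?thesis using \<Phi> w by blast
qed

text \<open>The orthogonal projection of \<open>f\<close> onto the closure of \<open>S\<close> is the limit of a minimizing
  sequence, which is Cauchy by the parallelogram law.\<close>

lemma dense_if_orthogonal_trivial:
  assumes S: "subspace S" "S \<subseteq> V"
    and orth: "\<And>g. \<lbrakk>g \<in> V; \<And>s. s \<in> S \<Longrightarrow> ip g s = 0\<rbrakk> \<Longrightarrow> nrm g = 0"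
    and f: "f \<in> V" and "e > 0"
  shows "\<exists>s\<in>S. nrm (s - f) < e"
proof -
  define d where "d = (INF s\<in>S. (nrm (f - s))\<^sup>2)"
  have S0: "0 \<in> S" using S subspace_0 by blast
  have bdd: "bdd_below ((\<lambda>s. (nrm (f - s))\<^sup>2) ` S)" by (rule bdd_belowI[of _ 0]) auto
  have d_le: "d \<le> (nrm (f - s))\<^sup>2" if "s \<in> S" for s
    unfolding d_def using bdd that by (rule cINF_lower)
  have "\<exists>s\<in>S. (nrm (f - s))\<^sup>2 < d + inverse (real (Suc k))" for k
  proof -
    have "d < d + inverse (real (Suc k))" by simp
    then show ?thesis unfolding d_def using S0 bdd by (subst (asm) cINF_less_iff) auto
  qed
  then obtain X where XS: "\<And>k. X k \<in> S" and X: "\<And>k. (nrm (f - X k))\<^sup>2 < d + inverse (real (Suc k))"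
    by metis
  have XV: "X k \<in> V" for k using XS S by blast
  have par: "(nrm (X m - X n))\<^sup>2 \<le> 4 * inverse (real (Suc n))" if "n \<le> m" for m n
  proof -
    define p q where "p = f - X m" and "q = f - X n"
    have pq: "p \<in> V" "q \<in> V" using f XV by (auto simp: p_def q_def)
    \<comment> \<open>The midpoint lies in \<open>S\<close>, so its squared distance to
      \<open>f\<close> is at least \<open>d\<close>. The multiples of \<open>d\<close> in the
      parallelogram identity cancel, and only the excess of the two approximants over
      \<open>d\<close> remains.\<close>
    define s where "s = (1/2) \<odot> (X m + X n)"
    have sS: "s \<in> S" unfolding s_def using S XS by (intro subspace_scale subspace_add) auto
    have "p + q = 2 \<odot> (f - s)"
    proof -
      have "2 \<odot> (f - s) = 2 \<odot> f - 2 \<odot> s" by (rule scale_right_diff_distrib)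
      also have "2 \<odot> s = X m + X n" by (simp add: s_def)
      also have "2 \<odot> f = f + f" using scale_left_distrib[of 1 1 f] by simp
      finally show ?thesis by (simp add: p_def q_def)
    qed
    then have "(nrm (p + q))\<^sup>2 = 4 * (nrm (f - s))\<^sup>2"
      using f sS S by (auto simp: nrm_scale power_mult_distrib)
    then have "(nrm (p - q))\<^sup>2 = 2 * (nrm p)\<^sup>2 + 2 * (nrm q)\<^sup>2 - 4 * (nrm (f - s))\<^sup>2"
      using nrm_add_sq[OF pq] nrm_diff_sq[OF pq] by simp
    moreover have "(nrm (p - q))\<^sup>2 = (nrm (X m - X n))\<^sup>2"
      using nrm_diff_commute[OF XV XV, of m n] by (simp add: p_def q_def)
    moreover have "inverse (real (Suc m)) \<le> inverse (real (Suc n))" using that by simp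
    ultimately show ?thesis
      using X[of m] X[of n] d_le[OF sS] unfolding p_def q_def by linarith
  qed
  have "\<exists>x\<in>V. (\<lambda>k. nrm (X k - x)) \<longlonglongrightarrow> 0"
  proof (rule complete)
    show "nrm (X m - X n) \<le> sqrt (4 * inverse (real (Suc n)))" if "n \<le> m" for m n
      using par[OF that] by (rule real_le_rsqrt)
    show "(\<lambda>n. sqrt (4 * inverse (real (Suc n)))) \<longlonglongrightarrow> 0"
      using tendsto_real_sqrt[OF tendsto_mult_right_zero[OF LIMSEQ_inverse_real_of_nat, of 4]] by simp
  qed (rule XV)
  then obtain r where r: "r \<in> V" "(\<lambda>k. nrm (X k - r)) \<longlonglongrightarrow> 0" by blast
  define g where "g = f - r"
  have gV: "g \<in> V" using f r by (simp add: g_def)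
  have lim: "(\<lambda>k. (nrm (f - X k - s))\<^sup>2) \<longlonglongrightarrow> (nrm (g - s))\<^sup>2" if s: "s \<in> V" for s
  proof -
    have "(\<lambda>k. nrm (X k - (f - s))) \<longlonglongrightarrow> nrm (r - (f - s))"
      using r f s XV by (intro tendsto_nrm_diff) auto
    moreover have "nrm (X k - (f - s)) = nrm (f - X k - s)" for k
      using nrm_diff_commute[of "X k" "f - s"] f s XV[of k] by (simp add: algebra_simps)
    moreover have "nrm (r - (f - s)) = nrm (g - s)"
      using nrm_diff_commute[of r "f - s"] f s r by (simp add: g_def algebra_simps)
    ultimately show ?thesis by (auto intro!: tendsto_power)
  qed
  have le: "(nrm g)\<^sup>2 \<le> d"
  proof (rule LIMSEQ_le)
    show "(\<lambda>k. (nrm (f - X k))\<^sup>2) \<longlonglongrightarrow> (nrm g)\<^sup>2" using lim[of 0] by simp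
    show "(\<lambda>k. d + inverse (real (Suc k))) \<longlonglongrightarrow> d"
      using tendsto_add[OF tendsto_const LIMSEQ_inverse_real_of_nat, of d] by simp
  qed (use X less_imp_le in blast)
  \<comment> \<open>The limit \<open>r\<close> need not belong to \<open>S\<close>. The inequality
    holds for \<open>X k + s\<close>, which does, and is then passed to the limit.\<close>
  have ge: "d \<le> (nrm (g - s))\<^sup>2" if s: "s \<in> S" for s
  proof (rule LIMSEQ_le_const[OF lim])
    show "s \<in> V" using s S by blast
    have "d \<le> (nrm (f - X k - s))\<^sup>2" for k
      using d_le[of "X k + s"] subspace_add[OF S(1) XS s, of k] by (simp add: diff_diff_add)
    then show "\<exists>N. \<forall>k\<ge>N. d \<le> (nrm (f - X k - s))\<^sup>2" by blast
  qed
  have "ip g s = 0" if s: "s \<in> S" for s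
  proof -
    have sV: "s \<in> V" using s S by blast
    \<comment> \<open>The first variation needs \<open>0 < t\<close> and
      \<open>t * (nrm s)^2 < 2\<close>. The summand 1 keeps \<open>t\<close> defined when
      \<open>s\<close> has norm zero.\<close>
    define t where "t = 1 / ((nrm s)\<^sup>2 + 1)"
    define p where "p = (cmod (ip g s))\<^sup>2"
    have pos: "(nrm s)\<^sup>2 + 1 > 0" by (smt (verit) zero_le_power2)
    have t: "t > 0" "t * (nrm s)\<^sup>2 < 1" using pos by (simp_all add: t_def divide_simps)
    have "(nrm g)\<^sup>2 \<le> (nrm (g - (complex_of_real t * ip g s) \<odot> s))\<^sup>2"
      using le ge[OF subspace_scale[OF S(1) s]] by (rule order_trans)
    then have "0 \<le> t * p * (t * (nrm s)\<^sup>2 - 2)"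
      unfolding nrm_diff_scale_sq[OF gV sV] p_def by (simp add: algebra_simps power2_eq_square)
    moreover have "t * (nrm s)\<^sup>2 - 2 < 0" using t by simp
    ultimately have "t * p \<le> 0"
      by (simp add: zero_le_mult_iff)
    then have "p \<le> 0" using t by (simp add: mult_le_0_iff)
    then show ?thesis by (simp add: p_def)
  qed
  then have "nrm g = 0" using orth gV by blast
  then have "(\<lambda>k. nrm (X k - f)) \<longlonglongrightarrow> 0"
    using tendsto_nrm_diff[OF XV r(1) f r(2)] nrm_diff_commute[OF f r(1)] by (simp add: g_def)
  then have "\<forall>\<^sub>F k in sequentially. nrm (X k - f) < e"
    using \<open>e > 0\<close> by (rule order_tendstoD)
  then show ?thesis using XS by (auto simp: eventually_sequentially)
qed

text \<open>A vector orthogonal to the range of \<open>c - T\<close>, with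
  \<open>c = \<i> s\<close>, would satisfy the eigenvalue equation of \<open>adj T = T\<close> for
  the non-real number \<open>cnj c\<close>; symmetry then forces its norm to be zero. So the range
  is dense. The lower bound \<open>\<bar>s\<bar> * nrm w\<close> makes approximate preimages Cauchy,
  and closedness of \<open>adj T\<close> puts their limit into \<open>T\<close>.\<close>

lemma self_adjoint_shift_surj:
  assumes T: "lin_rel T" and sa: "adj T = T" and s: "s \<noteq> 0" and f: "f \<in> V"
  shows "\<exists>w h. (w, h) \<in> T \<and> nrm ((\<i> * complex_of_real s) \<odot> w - h - f) = 0"
proof -
  define c where "c = \<i> * complex_of_real s"
  have sym: "symmetric_rel T" using sa by (rule self_adjoint_symmetric)
  define S where "S = {c \<odot> w - h | w h. (w, h) \<in> T}"
  have "subspace S"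
  proof (rule subspaceI)
    show "0 \<in> S" unfolding S_def mem_Collect_eq
      by (rule exI[of _ 0], rule exI[of _ 0]) (simp add: lin_rel_0[OF T])
  next
    fix x y assume "x \<in> S" "y \<in> S"
    then obtain w h w' h' where "x = c \<odot> w - h" "(w, h) \<in> T" "y = c \<odot> w' - h'" "(w', h') \<in> T"
      by (auto simp: S_def)
    then have "x + y = c \<odot> (w + w') - (h + h')" "(w + w', h + h') \<in> T"
      using lin_rel_add[OF T] by (auto simp: scale_right_distrib)
    then show "x + y \<in> S" unfolding S_def by blast
  next
    fix a x assume "x \<in> S"
    then obtain w h where "x = c \<odot> w - h" "(w, h) \<in> T" by (auto simp: S_def)
    then have "a \<odot> x = c \<odot> (a \<odot> w) - a \<odot> h" "(a \<odot> w, a \<odot> h) \<in> T"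
      using lin_rel_scale[OF T] by (auto simp: scale_right_diff_distrib mult.commute)
    then show "a \<odot> x \<in> S" unfolding S_def by blast
  qed
  moreover have "S \<subseteq> V" unfolding S_def using lin_rel_V[OF T] by blast
  moreover have "nrm g = 0" if g: "g \<in> V" and orth: "\<And>x. x \<in> S \<Longrightarrow> ip g x = 0" for g
  proof -
    have "ip h g = ip w (cnj c \<odot> g)" if "(w, h) \<in> T" for w h
    proof -
      have wh: "w \<in> V" "h \<in> V" using lin_rel_V[OF T] that by blast+
      have "c \<odot> w - h \<in> S" using that unfolding S_def by blast
      then have "ip (c \<odot> w - h) g = 0"
        using orth[of "c \<odot> w - h"] ip_commute[of g "c \<odot> w - h"] wh g by simp
      then show ?thesis
        using wh g by (simp add: ip_diff_left ip_scale_left ip_scale_right)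
    qed
    then have "(g, cnj c \<odot> g) \<in> adj T" using g by (auto simp: adj_def)
    then have "(g, cnj c \<odot> g) \<in> T" by (simp add: sa)
    then have "Im (ip (cnj c \<odot> g) g) = 0" using symmetric_rel_Im[OF T sym] by blast
    then have "Im (cnj c * ip g g) = 0" using ip_scale_left[OF g g] by simp
    then show ?thesis using g s by (simp add: ip_self c_def)
  qed
  ultimately have dense: "\<exists>x\<in>S. nrm (x - f) < e" if "e > 0" for e
    using dense_if_orthogonal_trivial[of S f e] f that by blast
  have "\<exists>w h. (w, h) \<in> T \<and> nrm (c \<odot> w - h - f) < inverse (real (Suc k))" for k
    using dense[of "inverse (real (Suc k))"] unfolding S_def by auto
  then obtain W Hh where WT: "\<And>k. (W k, Hh k) \<in> T"
    and WH: "\<And>k. nrm (c \<odot> W k - Hh k - f) < inverse (real (Suc k))" by metis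
  have WV: "W k \<in> V" "Hh k \<in> V" for k using lin_rel_V[OF T] WT by blast+
  have "\<exists>w\<in>V. (\<lambda>k. nrm (W k - w)) \<longlonglongrightarrow> 0"
  proof (rule complete)
    fix m n :: nat assume nm: "n \<le> m"
    define y where "y k = c \<odot> W k - Hh k" for k
    have yV: "y k \<in> V" for k using WV by (simp add: y_def)
    have "\<bar>s\<bar> * nrm (W m - W n) \<le> nrm (c \<odot> (W m - W n) - (Hh m - Hh n))"
      unfolding c_def by (rule symmetric_rel_lower_bound[OF T sym lin_rel_diff[OF T WT WT]])
    also have "c \<odot> (W m - W n) - (Hh m - Hh n) = y m - y n"
      by (simp add: y_def scale_right_diff_distrib)
    also have "nrm (y m - y n) \<le> nrm (y m - f) + nrm (y n - f)"
      using nrm_diff_triangle[OF yV f yV] nrm_diff_commute[OF f yV] by simp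
    also have "\<dots> \<le> 2 * inverse (real (Suc n))"
    proof -
      have "inverse (real (Suc m)) \<le> inverse (real (Suc n))" using nm by simp
      then show ?thesis using WH[of m] WH[of n] unfolding y_def by linarith
    qed
    finally have "nrm (W m - W n) \<le> 2 * inverse (real (Suc n)) / \<bar>s\<bar>"
      using s by (simp add: pos_le_divide_eq mult.commute)
    then show "nrm (W m - W n) \<le> 2 / \<bar>s\<bar> * inverse (real (Suc n))" by simp
  next
    show "(\<lambda>n. 2 / \<bar>s\<bar> * inverse (real (Suc n))) \<longlonglongrightarrow> 0"
      by (rule tendsto_mult_right_zero[OF LIMSEQ_inverse_real_of_nat])
  qed (rule WV)
  then obtain w where w: "w \<in> V" "(\<lambda>k. nrm (W k - w)) \<longlonglongrightarrow> 0" by blast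
  \<comment> \<open>\<open>h\<close> is the value that the equation dictates at \<open>w\<close>;
    what remains is that the pair \<open>(w, h)\<close> is a limit of pairs in
    \<open>T\<close>.\<close>
  define h where "h = c \<odot> w - f"
  have hV: "h \<in> V" using w f by (simp add: h_def)
  have "(\<lambda>k. nrm (Hh k - h)) \<longlonglongrightarrow> 0"
  proof (rule Lim_null_comparison)
    show "\<forall>\<^sub>F k in sequentially. norm (nrm (Hh k - h))
        \<le> cmod c * nrm (W k - w) + inverse (real (Suc k))"
    proof (rule always_eventually, rule allI)
      fix k
      have eq: "Hh k - h = c \<odot> (W k - w) - (c \<odot> W k - Hh k - f)"
        by (simp add: h_def scale_right_diff_distrib)
      have "nrm (Hh k - h) \<le> nrm (c \<odot> (W k - w)) + nrm (c \<odot> W k - Hh k - f)"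
        unfolding eq using w f WV by (intro nrm_diff_le) auto
      moreover have "norm (nrm (Hh k - h)) = nrm (Hh k - h)" using WV hV by (simp add: nrm_nonneg)
      moreover have "nrm (c \<odot> (W k - w)) = cmod c * nrm (W k - w)" using w WV by (simp add: nrm_scale)
      ultimately show "norm (nrm (Hh k - h)) \<le> cmod c * nrm (W k - w) + inverse (real (Suc k))"
        using WH[of k] by linarith
    qed
    show "(\<lambda>k. cmod c * nrm (W k - w) + inverse (real (Suc k))) \<longlonglongrightarrow> 0"
      using tendsto_add[OF tendsto_mult_right_zero[OF w(2)] LIMSEQ_inverse_real_of_nat] by simp
  qed
  moreover have "T \<subseteq> V \<times> V" using T by (simp add: lin_rel_def)
  moreover have "(W k, Hh k) \<in> adj T" for k using WT by (simp only: sa)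
  ultimately have "(w, h) \<in> adj T"
    using w hV adj_closed[of T W Hh] by blast
  then have "(w, h) \<in> T" by (simp add: sa)
  moreover have "nrm (c \<odot> w - h - f) = 0" by (simp add: h_def)
  ultimately show ?thesis unfolding c_def by blast
qed

text \<open>Lax-Milgram: \<open>u\<close> is moved to \<open>u - \<epsilon> (B u - g)\<close>, where
  accretivity gives the decrease and boundedness controls the quadratic term. It supplies the
  \<open>u\<close> with \<open>B u = w\<close> for each \<open>w\<close> in the contraction for the
  resolvent.\<close>

lemma accretive_surj:
  assumes B: "lin_rel B" "Domain B = V"
    and bd: "\<And>u f. (u, f) \<in> B \<Longrightarrow> nrm f \<le> b * nrm u"
    and acc: "\<And>u f. (u, f) \<in> B \<Longrightarrow> \<beta> * (nrm u)\<^sup>2 \<le> Re (ip f u)"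
    and \<beta>: "\<beta> > 0" and g: "g \<in> V"
  shows "\<exists>u f. (u, f) \<in> B \<and> nrm (f - g) = 0"
proof -
  \<comment> \<open>The maximum guarantees \<open>K > 0\<close> and
    \<open>\<beta> / K \<le> 1\<close>, even if all vectors have norm zero and \<open>b\<close> says
    nothing.\<close>
  define K where "K = max b \<beta>"
  have K: "K \<ge> \<beta>" "K > 0" using \<beta> by (auto simp: K_def)
  have bdK: "nrm f \<le> K * nrm u" if "(u, f) \<in> B" for u f
  proof -
    have "u \<in> V" using lin_rel_V[OF B(1)] that by blast
    then have "b * nrm u \<le> K * nrm u" by (intro mult_right_mono) (auto simp: K_def nrm_nonneg)
    then show ?thesis using bd[OF that] by simp
  qed
  \<comment> \<open>This value minimizes \<open>1 - 2 \<epsilon> \<beta> + \<epsilon>^2 K^2\<close>;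
    the minimum is \<open>1 - (\<beta> / K)^2\<close>, the square of the contraction factor.\<close>
  define \<epsilon> where "\<epsilon> = \<beta> / K\<^sup>2"
  have \<epsilon>: "\<epsilon> > 0" using K \<beta> by (simp add: \<epsilon>_def)
  define q where "q = sqrt (1 - (\<beta> / K)\<^sup>2)"
  have q01: "0 \<le> 1 - (\<beta> / K)\<^sup>2" "1 - (\<beta> / K)\<^sup>2 < 1"
    using K \<beta> by (auto simp: power_le_one_iff)
  have q: "0 \<le> q" "q < 1" using q01 by (auto simp: q_def)
  define G where "G = {(u, u - complex_of_real \<epsilon> \<odot> (f - g)) | u f. (u, f) \<in> B}"
  have "\<exists>w w'. (w, w') \<in> G \<and> nrm (w' - w) = 0"
  proof (rule contraction_fixed_point[OF _ _ q])
    show "G \<subseteq> V \<times> V" using lin_rel_V[OF B(1)] g by (auto simp: G_def)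
    show "Domain G = V" using B(2) by (auto simp: G_def Domain_iff)
  next
    fix x x' y y' assume "(x, x') \<in> G" "(y, y') \<in> G"
    then obtain f f' where f: "(x, f) \<in> B" "x' = x - complex_of_real \<epsilon> \<odot> (f - g)"
      "(y, f') \<in> B" "y' = y - complex_of_real \<epsilon> \<odot> (f' - g)" by (auto simp: G_def)
    define u v where "u = x - y" and "v = f - f'"
    have uv: "(u, v) \<in> B" using lin_rel_diff[OF B(1)] f by (simp add: u_def v_def)
    have V: "u \<in> V" "v \<in> V" using lin_rel_V[OF B(1) uv] .
    have "x' - y' = u - complex_of_real \<epsilon> \<odot> v"
      by (simp add: f u_def v_def scale_right_diff_distrib)
    then have "(nrm (x' - y'))\<^sup>2 = (nrm u)\<^sup>2 - 2 * (\<epsilon> * Re (ip v u)) + \<epsilon>\<^sup>2 * (nrm v)\<^sup>2"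
      using V ip_commute[of v u]
      by (simp add: nrm_diff_sq ip_scale_right nrm_scale power_mult_distrib)
    also have "\<dots> \<le> (nrm u)\<^sup>2 - 2 * (\<epsilon> * (\<beta> * (nrm u)\<^sup>2)) + \<epsilon>\<^sup>2 * (K * nrm u)\<^sup>2"
      using acc[OF uv] bdK[OF uv] \<epsilon> V
      by (intro add_mono diff_mono mult_left_mono power_mono) (auto simp: nrm_nonneg)
    also have "\<dots> = (q * nrm u)\<^sup>2"
      using K q01 by (simp add: q_def \<epsilon>_def power_mult_distrib field_simps power2_eq_square)
    finally show "nrm (x' - y') \<le> q * nrm (x - y)"
      unfolding u_def[symmetric] by (rule power2_le_imp_le) (simp add: V q nrm_nonneg)
  qed
  then obtain u f where uf: "(u, f) \<in> B" "nrm (u - complex_of_real \<epsilon> \<odot> (f - g) - u) = 0"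
    by (auto simp: G_def)
  have fV: "f \<in> V" using lin_rel_V[OF B(1) uf(1)] by blast
  have "u - complex_of_real \<epsilon> \<odot> (f - g) - u = - (complex_of_real \<epsilon> \<odot> (f - g))" by simp
  then have "\<epsilon> * nrm (f - g) = 0"
    using uf(2) fV g \<epsilon> nrm_minus[of "complex_of_real \<epsilon> \<odot> (f - g)"] by (simp add: nrm_scale)
  then show ?thesis using uf \<epsilon> by auto
qed

end


text \<open>\<open>T\<close> is the self-adjoint part and \<open>\<kappa>\<close> stands for the
  tangent of the angle. \<open>B O D0\<close> applies \<open>B\<close> first, so \<open>a\<close>
  bounds the product \<open>D0 B\<close>. The bound of \<open>D0\<close> alone is existential: it
  may influence the auxiliary shift in the surjectivity proof, but must not enter the
  estimate.\<close>

locale perturbed_operator = semi_hilbert +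
  fixes T B D0 :: "('a \<times> 'a) set" and a b \<beta> \<kappa> \<delta> :: real and l :: complex
  assumes T: "lin_rel T" "adj T = T"
    and B: "lin_rel B" "Domain B = V"
    and B_cong: "\<And>u f g. \<lbrakk>(u, f) \<in> B; g \<in> V; nrm (f - g) = 0\<rbrakk> \<Longrightarrow> (u, g) \<in> B"
    and D0: "lin_rel D0" "Domain D0 = V"
    and D0_bounded: "\<exists>K. \<forall>(u, f)\<in>D0. nrm f \<le> K * nrm u"
    and B_bound: "\<And>u f. (u, f) \<in> B \<Longrightarrow> nrm f \<le> b * nrm u"
    and D0B_bound: "\<And>u f. (u, f) \<in> B O D0 \<Longrightarrow> nrm f \<le> a * nrm u"
    and B_acc: "\<And>u f. (u, f) \<in> B \<Longrightarrow> \<beta> * (nrm u)\<^sup>2 \<le> Re (ip f u)"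
    and B_sector: "\<And>u f. (u, f) \<in> B \<Longrightarrow> \<bar>Im (ip f u)\<bar> \<le> \<kappa> * Re (ip f u)"
    and nonneg: "0 \<le> b" "0 < \<beta>" "0 \<le> \<kappa>"
    and \<delta>: "\<delta> = \<bar>Im l\<bar> - \<bar>Re l\<bar> * \<kappa>" "0 < \<delta>" "2 * (a * b) \<le> \<delta> * \<beta>"
begin

section \<open>Coercivity and the resolvent of the perturbed operator\<close>

lemma sgn_Im_l: "\<bar>sgn (Im l)\<bar> = 1" "sgn (Im l) * Im l = \<bar>Im l\<bar>"
proof -
  have "0 \<le> \<bar>Re l\<bar> * \<kappa>" using nonneg by simp
  then have "Im l \<noteq> 0" using \<delta> by auto
  then show "\<bar>sgn (Im l)\<bar> = 1" "sgn (Im l) * Im l = \<bar>Im l\<bar>"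
    by (auto simp: sgn_if)
qed

text \<open>For \<open>z = ip w u\<close> the inner product is \<open>l * cnj z\<close>, with
  imaginary part \<open>Im l * Re z - Re l * Im z\<close>; the sector condition bounds the second
  term by \<open>\<bar>Re l\<bar> * \<kappa> * Re z\<close>. The sign is kept instead of a modulus
  because it is the same for all \<open>u\<close>, and this definiteness drives the contraction in
  \<open>resolvent_surj\<close>.\<close>

lemma lower_bound_scale:
  assumes uw: "(u, w) \<in> B"
  shows "\<delta> * \<beta> * (nrm u)\<^sup>2 \<le> sgn (Im l) * Im (ip (l \<odot> u) w)"
proof -
  have V: "u \<in> V" "w \<in> V" using lin_rel_V[OF B(1) uw] .
  define z where "z = ip w u"
  have "sgn (Im l) * Re l * Im z \<le> \<bar>sgn (Im l) * Re l * Im z\<bar>" by simp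
  also have "\<dots> = \<bar>Re l\<bar> * \<bar>Im z\<bar>"
    using sgn_Im_l by (simp add: abs_mult)
  also have "\<dots> \<le> \<bar>Re l\<bar> * (\<kappa> * Re z)"
    using B_sector[OF uw] by (intro mult_left_mono) (auto simp: z_def)
  finally have "\<delta> * Re z \<le> \<bar>Im l\<bar> * Re z - sgn (Im l) * Re l * Im z"
    unfolding \<delta>(1) by (simp add: algebra_simps)
  also have "\<dots> = sgn (Im l) * Im (l * cnj z)"
    using sgn_Im_l(2) by (simp add: algebra_simps)
  also have "l * cnj z = ip (l \<odot> u) w"
    using V ip_commute[of w u] by (simp add: ip_scale_left z_def)
  finally have "\<delta> * Re z \<le> sgn (Im l) * Im (ip (l \<odot> u) w)" .
  moreover have "\<delta> * (\<beta> * (nrm u)\<^sup>2) \<le> \<delta> * Re z"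
    using B_acc[OF uw] \<delta> by (intro mult_left_mono) (auto simp: z_def)
  ultimately show ?thesis by (simp add: mult.assoc)
qed

lemma Im_le:
  assumes "x \<in> V" "y \<in> V"
  shows "sgn (Im l) * Im (ip x y) \<le> nrm x * nrm y"
proof -
  have "sgn (Im l) * Im (ip x y) \<le> \<bar>sgn (Im l) * Im (ip x y)\<bar>" by simp
  also have "\<dots> \<le> cmod (ip x y)" using sgn_Im_l abs_Im_le_cmod[of "ip x y"] by (simp add: abs_mult)
  also have "\<dots> \<le> nrm x * nrm y" using assms by (rule Cauchy_Schwarz)
  finally show ?thesis .
qed

text \<open>The condition \<open>2 * (a * b) \<le> \<delta> * \<beta>\<close> is calibrated for
  this: the perturbation consumes at most half of the coercivity from
  \<open>lower_bound_scale\<close>.\<close>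

lemma D0B_nrm_mult_le:
  assumes "(u, w) \<in> B" "(w, h) \<in> D0"
  shows "nrm h * nrm w \<le> \<delta> * \<beta> / 2 * (nrm u)\<^sup>2"
proof -
  have V: "u \<in> V" "w \<in> V" "h \<in> V"
    using lin_rel_V[OF B(1)] lin_rel_V[OF D0(1)] assms by blast+
  have h: "nrm h \<le> a * nrm u" using D0B_bound assms by blast
  \<comment> \<open>Monotonicity of the product needs \<open>0 \<le> a * nrm u\<close>, which comes
    from \<open>0 \<le> nrm h \<le> a * nrm u\<close>.\<close>
  have "nrm h * nrm w \<le> (a * nrm u) * (b * nrm u)"
    using h B_bound[OF assms(1)] order_trans[OF nrm_nonneg[OF V(3)] h] V
    by (intro mult_mono) (auto simp: nrm_nonneg)
  also have "\<dots> = (a * b) * (nrm u)\<^sup>2" by (simp add: power2_eq_square)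
  also have "\<dots> \<le> \<delta> * \<beta> / 2 * (nrm u)\<^sup>2"
    using \<delta>(3) by (intro mult_right_mono) auto
  finally show ?thesis .
qed

lemma resolvent_bound:
  assumes "(u, w) \<in> B" "(w, g) \<in> T" "(w, h) \<in> D0"
  shows "\<delta> * \<beta> * nrm u \<le> 2 * b * nrm (l \<odot> u - g - h)"
proof -
  have V: "u \<in> V" "w \<in> V" "g \<in> V" "h \<in> V"
    using lin_rel_V[OF B(1)] lin_rel_V[OF D0(1)] lin_rel_V[OF T(1)] assms by blast+
  define F where "F = l \<odot> u - g - h"
  have FV: "F \<in> V" using V by (simp add: F_def)
  have "Im (ip g w) = 0"
    using symmetric_rel_Im[OF T(1) self_adjoint_symmetric[OF T(2)] assms(2)] .
  then have "Im (ip (l \<odot> u) w) = Im (ip F w) + Im (ip h w)"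
    using V by (simp add: F_def ip_diff_left)
  then have "\<delta> * \<beta> * (nrm u)\<^sup>2 \<le> sgn (Im l) * Im (ip F w) + sgn (Im l) * Im (ip h w)"
    using lower_bound_scale[OF assms(1)] by (simp add: distrib_left)
  also have "\<dots> \<le> nrm F * nrm w + nrm h * nrm w"
    using Im_le FV V by (intro add_mono) auto
  also have "\<dots> \<le> nrm F * (b * nrm u) + \<delta> * \<beta> / 2 * (nrm u)\<^sup>2"
    using B_bound[OF assms(1)] D0B_nrm_mult_le[OF assms(1,3)] FV
    by (intro add_mono mult_left_mono) (auto simp: nrm_nonneg)
  finally have *: "nrm u * (\<delta> * \<beta> * nrm u) \<le> nrm u * (2 * b * nrm F)"
    by (simp add: power2_eq_square algebra_simps)
  show ?thesis
  proof (cases "nrm u = 0")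
    case True
    then show ?thesis using nonneg FV nrm_nonneg[of F] by (simp add: F_def)
  next
    case False
    then have "nrm u > 0" using nrm_nonneg[OF V(1)] by simp
    then show ?thesis using * by (simp add: F_def)
  qed
qed

text \<open>With \<open>A w = l u - D0 w\<close> for \<open>w = B u\<close>, the solution is the fixed point of
  \<open>w \<mapsto> (\<i> s - T)\<^sup>-\<^sup>1 (f + \<i> s w - A w)\<close>, which is a contraction for large \<open>s\<close> of the sign of
  \<open>Im l\<close>, since \<open>A\<close> is bounded and its imaginary part is definite.\<close>

lemma resolvent_surj:
  assumes f: "f \<in> V"
  shows "\<exists>u w g h. (u, w) \<in> B \<and> (w, g) \<in> T \<and> (w, h) \<in> D0 \<and> nrm (l \<odot> u - g - h - f) = 0"
proof -
  \<comment> \<open>\<open>accretive_surj\<close> reaches \<open>w\<close> only up to a vector of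
    norm zero; \<open>B_cong\<close> makes the value exact.\<close>
  have B_surj: "\<exists>u. (u, w) \<in> B" if "w \<in> V" for w
    using accretive_surj[OF B B_bound B_acc _ that] nonneg B_cong that by blast
  obtain K where K: "\<And>u f. (u, f) \<in> D0 \<Longrightarrow> nrm f \<le> K * nrm u"
    using D0_bounded by blast
  \<comment> \<open>Half of the coercivity, expressed in \<open>w\<close> instead of
    \<open>u\<close> through \<open>nrm w \<le> (b + 1) * nrm u\<close>. Using \<open>b + 1\<close>
    avoids a division by zero.\<close>
  define \<gamma> where "\<gamma> = \<delta> * \<beta> / (2 * (b + 1)\<^sup>2)"
  have \<gamma>: "\<gamma> > 0" using \<delta> nonneg by (simp add: \<gamma>_def)
  \<comment> \<open>Accretivity gives \<open>\<beta> * nrm u \<le> nrm w\<close>, so the first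
    argument of \<open>max\<close> bounds \<open>A\<close>. The maximum with \<open>\<gamma>\<close>
    ensures \<open>\<alpha> > 0\<close> and \<open>s \<ge> \<alpha>\<close>.\<close>
  define \<alpha> where "\<alpha> = max (cmod l / \<beta> + \<bar>K\<bar>) \<gamma>"
  \<comment> \<open>Chosen so that \<open>s * \<gamma> = \<alpha>^2\<close>: then
    \<open>s^2 - 2 s \<gamma> + \<alpha>^2\<close> becomes \<open>s^2 - \<alpha>^2\<close>, and
    dividing by the lower bound \<open>s\<close> of the shifted \<open>T\<close> leaves a factor
    below 1.\<close>
  define s where "s = \<alpha>\<^sup>2 / \<gamma>"
  have \<alpha>: "\<alpha> \<ge> \<gamma>" "\<alpha> > 0" using \<gamma> by (auto simp: \<alpha>_def)
  have s: "s \<ge> \<alpha>" "s > 0" using \<gamma> \<alpha> by (auto simp: s_def power2_eq_square field_simps)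
  have A_bound: "nrm (l \<odot> u - h) \<le> \<alpha> * nrm w" if "(u, w) \<in> B" "(w, h) \<in> D0" for u w h
  proof -
    have V: "u \<in> V" "w \<in> V" "h \<in> V"
      using lin_rel_V[OF B(1)] lin_rel_V[OF D0(1)] that by blast+
    have "nrm u * (\<beta> * nrm u) \<le> nrm u * nrm w"
      using B_acc[OF that(1)] complex_Re_le_cmod[of "ip w u"] Cauchy_Schwarz[of w u] V
      by (simp add: power2_eq_square algebra_simps)
    then have "\<beta> * nrm u \<le> nrm w"
      using nrm_nonneg[OF V(1)] nrm_nonneg[OF V(2)] by (cases "nrm u = 0") auto
    then have "cmod l * nrm u \<le> cmod l * (nrm w / \<beta>)"
      using nonneg by (intro mult_left_mono) (auto simp: field_simps)
    moreover have "nrm h \<le> \<bar>K\<bar> * nrm w"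
      using K[OF that(2)] mult_right_mono[OF abs_ge_self[of K] nrm_nonneg[OF V(2)]] by simp
    moreover have "nrm (l \<odot> u - h) \<le> cmod l * nrm u + nrm h"
      using nrm_diff_le[of "l \<odot> u" h] V by (simp add: nrm_scale)
    ultimately have "nrm (l \<odot> u - h) \<le> (cmod l / \<beta> + \<bar>K\<bar>) * nrm w"
      by (simp add: algebra_simps)
    also have "\<dots> \<le> \<alpha> * nrm w" using V by (intro mult_right_mono) (auto simp: \<alpha>_def nrm_nonneg)
    finally show ?thesis .
  qed
  have A_Im: "\<gamma> * (nrm w)\<^sup>2 \<le> sgn (Im l) * Im (ip (l \<odot> u - h) w)"
    if "(u, w) \<in> B" "(w, h) \<in> D0" for u w h
  proof -
    have V: "u \<in> V" "w \<in> V" "h \<in> V"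
      using lin_rel_V[OF B(1)] lin_rel_V[OF D0(1)] that by blast+
    have "nrm w \<le> (b + 1) * nrm u"
      using B_bound[OF that(1)] nrm_nonneg[OF V(1)] by (simp add: algebra_simps)
    then have "(nrm w)\<^sup>2 \<le> ((b + 1) * nrm u)\<^sup>2" using V by (intro power_mono) (auto simp: nrm_nonneg)
    then have "\<gamma> * (nrm w)\<^sup>2 \<le> \<gamma> * ((b + 1) * nrm u)\<^sup>2" using \<gamma> by (intro mult_left_mono) auto
    also have "\<dots> = \<delta> * \<beta> / 2 * (nrm u)\<^sup>2"
      using nonneg by (simp add: \<gamma>_def power_mult_distrib)
    also have "\<dots> \<le> \<delta> * \<beta> * (nrm u)\<^sup>2 - nrm h * nrm w"
      using D0B_nrm_mult_le[OF that] by (simp add: field_simps)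
    also have "\<dots> \<le> sgn (Im l) * Im (ip (l \<odot> u) w) - sgn (Im l) * Im (ip h w)"
      using lower_bound_scale[OF that(1)] Im_le[of h w] V by (intro diff_mono) auto
    also have "\<dots> = sgn (Im l) * Im (ip (l \<odot> u - h) w)"
      using V by (simp add: ip_diff_left right_diff_distrib)
    finally show ?thesis .
  qed
  \<comment> \<open>With the sign of \<open>Im l\<close> in the shift, the cross term
    \<open>Re (ip (c w) v)\<close> is \<open>s\<close> times the quantity bounded below in
    \<open>A_Im\<close>, so it reduces the norm of \<open>c w - v\<close>.\<close>
  define c where "c = \<i> * complex_of_real (sgn (Im l) * s)"
  have cmod_c: "cmod c = s" using sgn_Im_l s by (simp add: c_def norm_mult abs_mult)
  have q01: "0 \<le> s\<^sup>2 - \<alpha>\<^sup>2" "s\<^sup>2 - \<alpha>\<^sup>2 < s\<^sup>2" using s \<alpha> by (auto intro!: power_mono)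
  define q where "q = sqrt (s\<^sup>2 - \<alpha>\<^sup>2) / s"
  have "sqrt (s\<^sup>2 - \<alpha>\<^sup>2) < s"
    using q01 s by (intro real_less_lsqrt) auto
  then have q: "0 \<le> q" "q < 1" using q01 s by (auto simp: q_def)
  \<comment> \<open>The equation for \<open>w'\<close> holds only up to norm zero, as
    \<open>self_adjoint_shift_surj\<close> provides nothing sharper, and \<open>u\<close> and
    \<open>h\<close> are not unique either; hence a relation and not a function.\<close>
  define G where "G = {(w, w'). \<exists>u h y. (u, w) \<in> B \<and> (w, h) \<in> D0 \<and> (w', y) \<in> T \<and>
      nrm (c \<odot> w' - y - (f + c \<odot> w - (l \<odot> u - h))) = 0}"
  have "\<exists>w w'. (w, w') \<in> G \<and> nrm (w' - w) = 0"
  proof (rule contraction_fixed_point[OF _ _ q])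
    show sub: "G \<subseteq> V \<times> V"
      using lin_rel_V[OF B(1)] lin_rel_V[OF T(1)] by (auto simp: G_def)
    have "w \<in> Domain G" if w: "w \<in> V" for w
    proof -
      obtain u h where uh: "(u, w) \<in> B" "(w, h) \<in> D0" using B_surj D0(2) w by blast
      then have "f + c \<odot> w - (l \<odot> u - h) \<in> V"
        using lin_rel_V[OF B(1)] lin_rel_V[OF D0(1)] f by blast
      then obtain w' y where "(w', y) \<in> T" "nrm (c \<odot> w' - y - (f + c \<odot> w - (l \<odot> u - h))) = 0"
        using self_adjoint_shift_surj[OF T, of "sgn (Im l) * s"] sgn_Im_l s unfolding c_def
        by (metis abs_0 mult_eq_0_iff order_less_irrefl zero_neq_one)
      then show ?thesis using uh unfolding G_def by blast
    qed
    then show "Domain G = V" using sub by blast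
  next
    fix w1 w1' w2 w2' assume "(w1, w1') \<in> G" "(w2, w2') \<in> G"
    then obtain u1 h1 y1 u2 h2 y2
      where 1: "(u1, w1) \<in> B" "(w1, h1) \<in> D0" "(w1', y1) \<in> T"
          "nrm (c \<odot> w1' - y1 - (f + c \<odot> w1 - (l \<odot> u1 - h1))) = 0"
        and 2: "(u2, w2) \<in> B" "(w2, h2) \<in> D0" "(w2', y2) \<in> T"
          "nrm (c \<odot> w2' - y2 - (f + c \<odot> w2 - (l \<odot> u2 - h2))) = 0"
      unfolding G_def by auto
    define u w w' h y where "u = u1 - u2" and "w = w1 - w2" and "w' = w1' - w2'"
      and "h = h1 - h2" and "y = y1 - y2"
    have rel: "(u, w) \<in> B" "(w, h) \<in> D0" "(w', y) \<in> T"
      unfolding u_def w_def w'_def h_def y_def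
      using 1 2 by (auto intro: lin_rel_diff[OF B(1)] lin_rel_diff[OF D0(1)] lin_rel_diff[OF T(1)])
    have V: "u \<in> V" "w \<in> V" "w' \<in> V" "h \<in> V" "y \<in> V"
      using lin_rel_V[OF B(1)] lin_rel_V[OF D0(1)] lin_rel_V[OF T(1)] rel by blast+
    have V': "u1 \<in> V" "w1 \<in> V" "w1' \<in> V" "h1 \<in> V" "y1 \<in> V" "u2 \<in> V" "w2 \<in> V" "w2' \<in> V" "h2 \<in> V" "y2 \<in> V"
      using lin_rel_V[OF B(1)] lin_rel_V[OF D0(1)] lin_rel_V[OF T(1)] 1 2 by blast+
    define v where "v = l \<odot> u - h"
    have vV: "v \<in> V" using V by (simp add: v_def)
    define E1 E2 where "E1 = c \<odot> w1' - y1 - (f + c \<odot> w1 - (l \<odot> u1 - h1))"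
      and "E2 = c \<odot> w2' - y2 - (f + c \<odot> w2 - (l \<odot> u2 - h2))"
    have EV: "E1 \<in> V" "E2 \<in> V" using V' f by (auto simp: E1_def E2_def)
    have "c \<odot> w' - y - (c \<odot> w - v) = E1 - E2"
      by (simp add: E1_def E2_def v_def u_def w_def w'_def h_def y_def scale_right_diff_distrib)
    moreover have "nrm (E1 - E2) \<le> 0" using nrm_diff_le[OF EV] 1 2 by (simp add: E1_def E2_def)
    ultimately have "nrm (c \<odot> w' - y) = nrm (c \<odot> w - v)"
      using V vV EV nrm_nonneg[of "E1 - E2"] by (intro nrm_cong) auto
    moreover have "s * nrm w' \<le> nrm (c \<odot> w' - y)"
      using symmetric_rel_lower_bound[OF T(1) self_adjoint_symmetric[OF T(2)] rel(3),
          of "sgn (Im l) * s"] sgn_Im_l s by (simp add: c_def abs_mult)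
    moreover have "(nrm (c \<odot> w - v))\<^sup>2 \<le> (sqrt (s\<^sup>2 - \<alpha>\<^sup>2) * nrm w)\<^sup>2"
    proof -
      have "Re (ip (c \<odot> w) v) = s * (sgn (Im l) * Im (ip v w))"
        using V vV ip_commute[of v w] by (simp add: ip_scale_left c_def)
      then have "(nrm (c \<odot> w - v))\<^sup>2
          = s\<^sup>2 * (nrm w)\<^sup>2 - 2 * (s * (sgn (Im l) * Im (ip v w))) + (nrm v)\<^sup>2"
        using V vV by (simp add: nrm_diff_sq nrm_scale cmod_c power_mult_distrib)
      also have "\<dots> \<le> s\<^sup>2 * (nrm w)\<^sup>2 - 2 * (s * (\<gamma> * (nrm w)\<^sup>2)) + (\<alpha> * nrm w)\<^sup>2"
        using A_bound[OF rel(1,2)] A_Im[OF rel(1,2)] s V vV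
        by (intro add_mono diff_mono mult_left_mono power_mono) (auto simp: v_def nrm_nonneg)
      also have "\<dots> = (s\<^sup>2 - 2 * (s * \<gamma>) + \<alpha>\<^sup>2) * (nrm w)\<^sup>2"
        by (simp add: algebra_simps power_mult_distrib)
      also have "s * \<gamma> = \<alpha>\<^sup>2" using \<gamma> by (simp add: s_def)
      finally show ?thesis using q01 by (simp add: power_mult_distrib algebra_simps)
    qed
    then have "nrm (c \<odot> w - v) \<le> sqrt (s\<^sup>2 - \<alpha>\<^sup>2) * nrm w"
      by (rule power2_le_imp_le) (simp only: V q01 nrm_nonneg real_sqrt_ge_zero mult_nonneg_nonneg)
    ultimately have "s * nrm w' \<le> sqrt (s\<^sup>2 - \<alpha>\<^sup>2) * nrm w" by simp
    then show "nrm (w1' - w2') \<le> q * nrm (w1 - w2)"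
      using s by (simp add: q_def w_def w'_def field_simps)
  qed
  then obtain w w' u h y where w: "nrm (w' - w) = 0" "(u, w) \<in> B" "(w, h) \<in> D0" "(w', y) \<in> T"
      and eq: "nrm (c \<odot> w' - y - (f + c \<odot> w - (l \<odot> u - h))) = 0" (is "nrm ?E = 0")
    unfolding G_def by blast
  have V: "u \<in> V" "w \<in> V" "w' \<in> V" "h \<in> V" "y \<in> V"
    using lin_rel_V[OF B(1)] lin_rel_V[OF D0(1)] lin_rel_V[OF T(1)] w by blast+
  \<comment> \<open>The fixed point gives \<open>(w', y)\<close> in \<open>T\<close> with
    \<open>w' - w\<close> of norm zero. The equations defining \<open>adj T = T\<close> cannot
    distinguish \<open>w'\<close> from \<open>w\<close>, so \<open>(w, y)\<close> is in
    \<open>T\<close> too.\<close>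
  have "ip x w = ip v y" if "(v, x) \<in> T" for v x
  proof -
    have "ip x w' = ip v y" using w(4) T(2) that unfolding adj_def by blast
    moreover have "ip x w' = ip x w"
      using V w(1) lin_rel_V[OF T(1) that] by (intro ip_cong_right) auto
    ultimately show ?thesis by simp
  qed
  then have "(w, y) \<in> adj T" using V by (auto simp: adj_def)
  then have wy: "(w, y) \<in> T" by (simp add: T(2))
  have EV: "?E \<in> V" using V f by simp
  have *: "l \<odot> u - y - h - f = ?E - c \<odot> (w' - w)" by (simp add: scale_right_diff_distrib)
  have "nrm (?E - c \<odot> (w' - w)) \<le> nrm ?E + nrm (c \<odot> (w' - w))"
    using V EV by (intro nrm_diff_le) auto
  also have "\<dots> = 0" using eq w(1) V by (simp add: nrm_scale)
  finally have "nrm (l \<odot> u - y - h - f) \<le> 0" unfolding * .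
  then have "nrm (l \<odot> u - y - h - f) = 0"
    using nrm_nonneg[of "l \<odot> u - y - h - f"] V f by simp
  then show ?thesis using w wy by blast
qed

end


section \<open>The space of square integrable fields\<close>

lemma summable_norm_diff_imp_convergent:
  fixes f :: "nat \<Rightarrow> 'a::banach"
  assumes "summable (\<lambda>k. norm (f (Suc k) - f k))"
  shows "convergent f"
proof -
  have "(\<lambda>n. \<Sum>k<n. f (Suc k) - f k) \<longlonglongrightarrow> (\<Sum>k. f (Suc k) - f k)"
    using summable_norm_cancel[OF assms] by (rule summable_LIMSEQ)
  then have "(\<lambda>n. (f n - f 0) + f 0) \<longlonglongrightarrow> (\<Sum>k. f (Suc k) - f k) + f 0"
    unfolding sum_lessThan_telescope by (intro tendsto_intros)
  then show ?thesis by (auto simp: convergent_def)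
qed

lemma L2_measurable: "\<lbrakk>u \<in> L2 \<mu> M; i < M\<rbrakk> \<Longrightarrow> (\<lambda>x. u x i) \<in> borel_measurable \<mu>"
  and L2_integrable: "\<lbrakk>u \<in> L2 \<mu> M; i < M\<rbrakk> \<Longrightarrow> integrable \<mu> (\<lambda>x. (cmod (u x i))\<^sup>2)"
  by (auto simp: L2_def)

lemma L2_0: "0 \<in> L2 \<mu> M"
  by (simp add: L2_def)

lemma L2_add:
  assumes "u \<in> L2 \<mu> M" "v \<in> L2 \<mu> M"
  shows "u + v \<in> L2 \<mu> M"
proof -
  have "integrable \<mu> (\<lambda>x. (cmod (u x i + v x i))\<^sup>2)" if i: "i < M" for i
  proof (rule Bochner_Integration.integrable_bound)
    show "integrable \<mu> (\<lambda>x. 2 * (cmod (u x i))\<^sup>2 + 2 * (cmod (v x i))\<^sup>2)"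
      using assms i by (intro Bochner_Integration.integrable_add integrable_mult_right L2_integrable)
    show "(\<lambda>x. (cmod (u x i + v x i))\<^sup>2) \<in> borel_measurable \<mu>"
      using L2_measurable[OF assms(1) i] L2_measurable[OF assms(2) i] by measurable
    have "(cmod (a + b))\<^sup>2 \<le> 2 * (cmod a)\<^sup>2 + 2 * (cmod b)\<^sup>2" for a b
    proof -
      have "(cmod (a + b))\<^sup>2 \<le> (cmod a + cmod b)\<^sup>2"
        by (intro power_mono norm_triangle_ineq) auto
      also have "\<dots> \<le> 2 * (cmod a)\<^sup>2 + 2 * (cmod b)\<^sup>2"
        using sum_squares_bound[of "cmod a" "cmod b"] by (simp add: power2_sum)
      finally show ?thesis .
    qed
    then show "AE x in \<mu>. norm ((cmod (u x i + v x i))\<^sup>2)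
        \<le> norm (2 * (cmod (u x i))\<^sup>2 + 2 * (cmod (v x i))\<^sup>2)"
      by simp
  qed
  then show ?thesis using assms by (auto simp: L2_def intro!: borel_measurable_add)
qed

lemma L2_scale: "u \<in> L2 \<mu> M \<Longrightarrow> scale c u \<in> L2 \<mu> M"
  by (auto simp: L2_def scale_def norm_mult power_mult_distrib)

lemma L2_integrable_inner:
  assumes "u \<in> L2 \<mu> M" "v \<in> L2 \<mu> M" "i < M"
  shows "integrable \<mu> (\<lambda>x. u x i * cnj (v x i))"
proof (rule Bochner_Integration.integrable_bound)
  show "integrable \<mu> (\<lambda>x. (cmod (u x i))\<^sup>2 + (cmod (v x i))\<^sup>2)"
    using assms by (intro Bochner_Integration.integrable_add L2_integrable)
  show "(\<lambda>x. u x i * cnj (v x i)) \<in> borel_measurable \<mu>"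
    using L2_measurable[OF assms(1,3)]
      measurable_compose[OF L2_measurable[OF assms(2,3)]
        borel_measurable_continuous_onI[OF continuous_on_cnj[OF continuous_on_id]]]
    by (rule borel_measurable_times)
  have "cmod a * cmod b \<le> (cmod a)\<^sup>2 + (cmod b)\<^sup>2" for a b
    using sum_squares_bound[of "cmod a" "cmod b"] mult_nonneg_nonneg[of "cmod a" "cmod b"]
    by (simp del: mult_nonneg_nonneg)
  then show "AE x in \<mu>. norm (u x i * cnj (v x i))
      \<le> norm ((cmod (u x i))\<^sup>2 + (cmod (v x i))\<^sup>2)"
    by (simp add: norm_mult)
qed

lemma L2_integrable_norm: "u \<in> L2 \<mu> M \<Longrightarrow> integrable \<mu> (\<lambda>x. \<Sum>i<M. (cmod (u x i))\<^sup>2)"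
  by (intro Bochner_Integration.integrable_sum L2_integrable) auto

lemma l2_inner_self:
  "l2_inner \<mu> M u u = complex_of_real (LINT x|\<mu>. (\<Sum>i<M. (cmod (u x i))\<^sup>2))"
  unfolding l2_inner_def complex_norm_square[symmetric]
  by (simp only: of_real_sum[symmetric] of_real_power[symmetric] integral_complex_of_real)

lemma scale_vector_space: "vector_space scale"
  by unfold_locales (auto simp: scale_def fun_eq_iff algebra_simps)

lemma semi_inner_L2: "semi_inner scale (L2 \<mu> M) (l2_inner \<mu> M)"
proof -
  interpret vector_space scale by (rule scale_vector_space)
  show ?thesis
  proof
    show "subspace (L2 \<mu> M)" by (intro subspaceI L2_0 L2_add L2_scale)
  next
    fix x y z assume "x \<in> L2 \<mu> M" "y \<in> L2 \<mu> M" "z \<in> L2 \<mu> M"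
    then show "l2_inner \<mu> M (x + y) z = l2_inner \<mu> M x z + l2_inner \<mu> M y z"
      unfolding l2_inner_def
      by (subst Bochner_Integration.integral_add[symmetric])
         (auto simp: distrib_right sum.distrib intro!: Bochner_Integration.integrable_sum L2_integrable_inner)
  next
    fix x y c assume "x \<in> L2 \<mu> M" "y \<in> L2 \<mu> M"
    then show "l2_inner \<mu> M (scale c x) y = c * l2_inner \<mu> M x y"
      unfolding l2_inner_def scale_def
      by (simp add: mult.assoc sum_distrib_left[symmetric])
  next
    fix x y assume "x \<in> L2 \<mu> M" "y \<in> L2 \<mu> M"
    show "l2_inner \<mu> M y x = cnj (l2_inner \<mu> M x y)"
      by (simp add: l2_inner_def Bochner_Integration.integral_cnj[symmetric] mult.commute
          del: Bochner_Integration.integral_cnj)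
  next
    fix x assume "x \<in> L2 \<mu> M"
    then show "0 \<le> Re (l2_inner \<mu> M x x)"
      by (simp add: l2_inner_self integral_nonneg_AE sum_nonneg)
  qed
qed

lemma nrm_L2: "semi_inner.nrm (l2_inner \<mu> M) = l2_norm \<mu> M"
  unfolding fun_eq_iff semi_inner.nrm_def[OF semi_inner_L2] l2_norm_def l2_inner_self by simp

interpretation L2_inner: semi_inner scale "L2 \<mu> M" "l2_inner \<mu> M"
  rewrites "semi_inner.nrm (l2_inner \<mu> M) = l2_norm \<mu> M" for \<mu> M
  by (rule semi_inner_L2) (rule nrm_L2)

lemma l2_norm_eq_0_iff:
  assumes "u \<in> L2 \<mu> M"
  shows "l2_norm \<mu> M u = 0 \<longleftrightarrow> (AE x in \<mu>. \<forall>i<M. u x i = 0)"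
proof -
  have "l2_norm \<mu> M u = 0 \<longleftrightarrow> (AE x in \<mu>. (\<Sum>i<M. (cmod (u x i))\<^sup>2) = 0)"
    unfolding l2_norm_def real_sqrt_eq_0_iff
    using assms by (intro integral_nonneg_eq_0_iff_AE L2_integrable_norm) (auto intro!: sum_nonneg)
  also have "\<dots> \<longleftrightarrow> (AE x in \<mu>. \<forall>i<M. u x i = 0)"
    by (intro AE_cong) (auto simp: sum_nonneg_eq_0_iff)
  finally show ?thesis .
qed

lemma ae_eq_iff_l2_norm:
  assumes "u \<in> L2 \<mu> M" "v \<in> L2 \<mu> M"
  shows "ae_eq \<mu> M u v \<longleftrightarrow> l2_norm \<mu> M (u - v) = 0"
  using l2_norm_eq_0_iff[of "u - v" \<mu> M] assms
  by (simp add: ae_eq_def)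

lemma nn_integral_eq_l2_norm:
  assumes "u \<in> L2 \<mu> M"
  shows "(\<integral>\<^sup>+x. ennreal (\<Sum>i<M. (cmod (u x i))\<^sup>2) \<partial>\<mu>) = ennreal ((l2_norm \<mu> M u)\<^sup>2)"
proof -
  have "0 \<le> (LINT x|\<mu>. (\<Sum>i<M. (cmod (u x i))\<^sup>2))"
    by (intro integral_nonneg_AE) (simp add: sum_nonneg)
  then show ?thesis
    using assms unfolding l2_norm_def
    by (subst nn_integral_eq_integral) (auto intro!: L2_integrable_norm sum_nonneg)
qed

text \<open>Fatou's lemma bounds a nonnegative integral before integrability of the limit is known;
  both membership and the norm bound are read off from it.\<close>

lemma L2_I:
  assumes meas: "\<And>i. i < M \<Longrightarrow> (\<lambda>x. u x i) \<in> borel_measurable \<mu>"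
    and bound: "(\<integral>\<^sup>+x. ennreal (\<Sum>i<M. (cmod (u x i))\<^sup>2) \<partial>\<mu>) \<le> ennreal (c\<^sup>2)" and "0 \<le> c"
  shows "u \<in> L2 \<mu> M" and "l2_norm \<mu> M u \<le> c"
proof -
  have "integrable \<mu> (\<lambda>x. (cmod (u x i))\<^sup>2)" if i: "i < M" for i
  proof (rule integrableI_nonneg)
    have "(\<integral>\<^sup>+x. ennreal ((cmod (u x i))\<^sup>2) \<partial>\<mu>) \<le> (\<integral>\<^sup>+x. ennreal (\<Sum>i<M. (cmod (u x i))\<^sup>2) \<partial>\<mu>)"
      using i by (intro nn_integral_mono ennreal_leI member_le_sum) auto
    also note bound
    also have "ennreal (c\<^sup>2) < \<infinity>" by simp
    finally show "(\<integral>\<^sup>+x. ennreal ((cmod (u x i))\<^sup>2) \<partial>\<mu>) < \<infinity>" .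
  qed (use meas[OF i] in auto)
  then show u: "u \<in> L2 \<mu> M" using meas by (auto simp: L2_def)
  have "(l2_norm \<mu> M u)\<^sup>2 \<le> c\<^sup>2"
    using bound unfolding nn_integral_eq_l2_norm[OF u] by (simp only: ennreal_le_iff zero_le_power2)
  then show "l2_norm \<mu> M u \<le> c" using \<open>0 \<le> c\<close> by (rule power2_le_imp_le)
qed

text \<open>Riesz-Fischer: a subsequence \<open>Y\<close> with \<open>\<parallel>Y\<^sub>k\<^sub>+\<^sub>1 - Y\<^sub>k\<parallel> < 2\<^sup>-\<^sup>k\<close> converges almost everywhere because
  \<open>\<Sum>\<^sub>k 2\<^sup>k |Y\<^sub>k\<^sub>+\<^sub>1 - Y\<^sub>k|\<^sup>2\<close> is integrable, and Fatou's lemma gives convergence in norm.\<close>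

lemma L2_complete:
  assumes X: "\<And>k. X k \<in> L2 \<mu> M"
    and Cauchy: "\<And>m n. n \<le> m \<Longrightarrow> l2_norm \<mu> M (X m - X n) \<le> e n" and e: "e \<longlonglongrightarrow> 0"
  shows "\<exists>u\<in>L2 \<mu> M. (\<lambda>k. l2_norm \<mu> M (X k - u)) \<longlonglongrightarrow> 0"
proof -
  have e_nonneg: "0 \<le> e n" for n using Cauchy[of n n] L2_inner.nrm_zero[of \<mu> M] by simp
  have "\<exists>N. \<forall>n\<ge>N. e n < (1/2) ^ k" for k
    using order_tendstoD(2)[OF e, of "(1/2) ^ k"] by (simp add: eventually_sequentially)
  then obtain N where N: "\<And>k n. n \<ge> N k \<Longrightarrow> e n < (1/2) ^ k" by metis
  \<comment> \<open>Cumulative sums make \<open>r\<close> monotone with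
    \<open>r k \<ge> N k\<close>; the \<open>Suc\<close> adds \<open>r k \<ge> k\<close>, which the
    final estimate uses to reach indices beyond \<open>n\<close>.\<close>
  define r where "r k = (\<Sum>j\<le>k. Suc (N j))" for k
  have r_N: "N k \<le> r k" for k
    using member_le_sum[of k "{..k}" "\<lambda>j. Suc (N j)"] by (simp add: r_def)
  have r_mono: "r k \<le> r (Suc k)" for k by (simp add: r_def)
  have r_ge: "k \<le> r k" for k
  proof -
    have "(\<Sum>j\<le>k. 1) \<le> r k" unfolding r_def by (intro sum_mono) auto
    then show ?thesis by simp
  qed
  define Y where "Y k = X (r k)" for k
  have YL2: "Y k \<in> L2 \<mu> M" for k by (simp add: Y_def X)
  have Ym: "(\<lambda>x. Y k x i) \<in> borel_measurable \<mu>" if "i < M" for k i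
    using L2_measurable[OF YL2 that] .
  have Xm: "(\<lambda>x. X k x i) \<in> borel_measurable \<mu>" if "i < M" for k i
    using L2_measurable[OF X that] .
  define g where "g k x = (\<Sum>i<M. (cmod (Y (Suc k) x i - Y k x i))\<^sup>2)" for k x
  have g_nonneg: "0 \<le> g k x" for k x by (simp add: g_def sum_nonneg)
  have g_meas: "g k \<in> borel_measurable \<mu>" for k
    unfolding g_def using Ym
    by (auto intro!: borel_measurable_sum borel_measurable_power borel_measurable_norm borel_measurable_diff)
  \<comment> \<open>The squared norms are at most \<open>(1/4) ^ k\<close>, so a weight
    \<open>2 ^ k\<close> keeps the series summable; finiteness of the weighted series at a point
    then forces geometric decay of the increments.\<close>
  have "(\<integral>\<^sup>+x. ennreal (2 ^ k * g k x) \<partial>\<mu>) \<le> ennreal ((1/2) ^ k)" for k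
  proof -
    have "(\<integral>\<^sup>+x. ennreal (2 ^ k * g k x) \<partial>\<mu>) = ennreal (2 ^ k) * (\<integral>\<^sup>+x. ennreal (g k x) \<partial>\<mu>)"
      using g_meas by (simp add: ennreal_mult g_nonneg nn_integral_cmult)
    also have "(\<integral>\<^sup>+x. ennreal (g k x) \<partial>\<mu>) = ennreal ((l2_norm \<mu> M (Y (Suc k) - Y k))\<^sup>2)"
      using nn_integral_eq_l2_norm[of "Y (Suc k) - Y k" \<mu> M] YL2 by (simp add: g_def)
    also have "ennreal (2 ^ k) * \<dots> = ennreal (2 ^ k * (l2_norm \<mu> M (Y (Suc k) - Y k))\<^sup>2)"
      by (simp add: ennreal_mult)
    also have "\<dots> \<le> ennreal (2 ^ k * ((1/2) ^ k)\<^sup>2)"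
    proof (intro ennreal_leI mult_left_mono power_mono)
      show "l2_norm \<mu> M (Y (Suc k) - Y k) \<le> (1/2) ^ k"
        using Cauchy[OF r_mono[of k]] N[OF r_N[of k]] by (simp add: Y_def)
      show "0 \<le> l2_norm \<mu> M (Y (Suc k) - Y k)"
        using YL2 by (intro L2_inner.nrm_nonneg) auto
    qed simp
    also have "2 ^ k * ((1/2) ^ k)\<^sup>2 = (1/2 :: real) ^ k"
      by (simp add: power2_eq_square power_one_over)
    finally show ?thesis .
  qed
  then have "(\<Sum>k. \<integral>\<^sup>+x. ennreal (2 ^ k * g k x) \<partial>\<mu>) \<le> (\<Sum>k. ennreal ((1/2) ^ k))"
    by (intro suminf_le) auto
  also have "\<dots> = ennreal (\<Sum>k. (1/2) ^ k)"
    by (intro suminf_ennreal2 summable_geometric) auto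
  finally have "(\<integral>\<^sup>+x. (\<Sum>k. ennreal (2 ^ k * g k x)) \<partial>\<mu>) \<le> ennreal (\<Sum>k. (1/2) ^ k)"
    using g_meas by (subst nn_integral_suminf) auto
  then have "(\<integral>\<^sup>+x. (\<Sum>k. ennreal (2 ^ k * g k x)) \<partial>\<mu>) \<noteq> \<infinity>"
    using neq_top_trans[OF ennreal_neq_top] by simp
  then have "AE x in \<mu>. (\<Sum>k. ennreal (2 ^ k * g k x)) \<noteq> \<infinity>"
    using g_meas by (intro nn_integral_PInf_AE) auto
  then have conv: "AE x in \<mu>. \<forall>i<M. convergent (\<lambda>k. Y k x i)"
  proof (rule AE_mp, intro AE_I2 impI allI)
    fix x i assume fin: "(\<Sum>k. ennreal (2 ^ k * g k x)) \<noteq> \<infinity>" and i: "i < M"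
    obtain s where s: "0 \<le> s" "(\<Sum>k. ennreal (2 ^ k * g k x)) = ennreal s"
      using fin by (cases "\<Sum>k. ennreal (2 ^ k * g k x)") auto
    have bd: "cmod (Y (Suc k) x i - Y k x i) \<le> sqrt s * sqrt (1/2) ^ k" for k
    proof -
      have "ennreal (2 ^ k * g k x) \<le> (\<Sum>k. ennreal (2 ^ k * g k x))"
        using sum_le_suminf[of "\<lambda>k. ennreal (2 ^ k * g k x)" "{k}"] by simp
      then have "2 ^ k * g k x \<le> s" using s by simp
      moreover have "(cmod (Y (Suc k) x i - Y k x i))\<^sup>2 \<le> g k x"
        unfolding g_def using i
        by (intro member_le_sum[of i "{..<M}" "\<lambda>i. (cmod (Y (Suc k) x i - Y k x i))\<^sup>2"]) auto
      ultimately have "2 ^ k * (cmod (Y (Suc k) x i - Y k x i))\<^sup>2 \<le> s"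
        by (meson mult_left_mono order_trans zero_le_numeral zero_le_power)
      then have "(cmod (Y (Suc k) x i - Y k x i))\<^sup>2 \<le> s * (1/2) ^ k"
        by (simp add: power_one_over pos_le_divide_eq mult.commute)
      then have "cmod (Y (Suc k) x i - Y k x i) \<le> sqrt (s * (1/2) ^ k)"
        by (rule real_le_rsqrt)
      then show ?thesis by (simp add: real_sqrt_mult real_sqrt_power)
    qed
    have "summable (\<lambda>k. sqrt s * sqrt (1/2) ^ k)"
      by (intro summable_mult summable_geometric) (simp add: real_sqrt_divide)
    then have "summable (\<lambda>k. cmod (Y (Suc k) x i - Y k x i))"
      by (rule summable_comparison_test'[where N = 0]) (simp add: bd)
    then show "convergent (\<lambda>k. Y k x i)" by (rule summable_norm_diff_imp_convergent)
  qed
  \<comment> \<open>Where the sequence diverges, \<open>lim\<close> has some unspecified value.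
    Measurability holds all the same, and such points form a null set by
    \<open>conv\<close>.\<close>
  define u where "u x i = lim (\<lambda>k. Y k x i)" for x i
  have um: "(\<lambda>x. u x i) \<in> borel_measurable \<mu>" if "i < M" for i
    unfolding u_def using Ym[OF that] by (rule borel_measurable_lim_metric)
  \<comment> \<open>Fatou with \<open>n\<close> fixed and \<open>k\<close> tending to infinity:
    \<open>Y k\<close> is some \<open>X m\<close> with \<open>m \<ge> n\<close> once
    \<open>k \<ge> n\<close>, so the modulus \<open>e n\<close> survives in the limit.\<close>
  have est: "(\<integral>\<^sup>+x. ennreal (\<Sum>i<M. (cmod ((X n - u) x i))\<^sup>2) \<partial>\<mu>) \<le> ennreal ((e n)\<^sup>2)" for n
  proof -
    have "AE x in \<mu>. ennreal (\<Sum>i<M. (cmod ((X n - u) x i))\<^sup>2)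
        = liminf (\<lambda>k. ennreal (\<Sum>i<M. (cmod ((X n - Y k) x i))\<^sup>2))"
      using conv
    proof (rule AE_mp, intro AE_I2 impI)
      fix x assume c: "\<forall>i<M. convergent (\<lambda>k. Y k x i)"
      then have "(\<lambda>k. Y k x i) \<longlonglongrightarrow> u x i" if "i < M" for i
        using that by (simp add: u_def convergent_LIMSEQ_iff)
      then have "(\<lambda>k. ennreal (\<Sum>i<M. (cmod ((X n - Y k) x i))\<^sup>2))
          \<longlonglongrightarrow> ennreal (\<Sum>i<M. (cmod ((X n - u) x i))\<^sup>2)"
        by (intro tendsto_ennrealI tendsto_sum tendsto_power tendsto_norm) (auto intro!: tendsto_intros)
      then show "ennreal (\<Sum>i<M. (cmod ((X n - u) x i))\<^sup>2)
          = liminf (\<lambda>k. ennreal (\<Sum>i<M. (cmod ((X n - Y k) x i))\<^sup>2))"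
        by (intro lim_imp_Liminf[symmetric]) auto
    qed
    then have "(\<integral>\<^sup>+x. ennreal (\<Sum>i<M. (cmod ((X n - u) x i))\<^sup>2) \<partial>\<mu>)
        = (\<integral>\<^sup>+x. liminf (\<lambda>k. ennreal (\<Sum>i<M. (cmod ((X n - Y k) x i))\<^sup>2)) \<partial>\<mu>)"
      by (rule nn_integral_cong_AE)
    also have "\<dots> \<le> liminf (\<lambda>k. \<integral>\<^sup>+x. ennreal (\<Sum>i<M. (cmod ((X n - Y k) x i))\<^sup>2) \<partial>\<mu>)"
      using Xm Ym by (intro nn_integral_liminf) (auto intro!: measurable_compose[OF _ measurable_ennreal] borel_measurable_sum borel_measurable_power borel_measurable_norm borel_measurable_diff)
    also have "\<dots> \<le> limsup (\<lambda>k. \<integral>\<^sup>+x. ennreal (\<Sum>i<M. (cmod ((X n - Y k) x i))\<^sup>2) \<partial>\<mu>)"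
      by (rule Liminf_le_Limsup) simp
    also have "\<dots> \<le> ennreal ((e n)\<^sup>2)"
    proof (rule Limsup_bounded, unfold eventually_sequentially, intro exI allI impI)
      fix k assume "n \<le> k"
      then have "n \<le> r k" using r_ge[of k] by simp
      then have "l2_norm \<mu> M (X n - Y k) \<le> e n"
        using Cauchy L2_inner.nrm_diff_commute[OF X X, of n "r k"] by (simp add: Y_def)
      then show "(\<integral>\<^sup>+x. ennreal (\<Sum>i<M. (cmod ((X n - Y k) x i))\<^sup>2) \<partial>\<mu>) \<le> ennreal ((e n)\<^sup>2)"
        using X YL2 by (subst nn_integral_eq_l2_norm) (auto intro!: ennreal_leI power_mono L2_inner.nrm_nonneg)
    qed
    finally show ?thesis .
  qed
  have "(\<lambda>x. (X n - u) x i) \<in> borel_measurable \<mu>" if "i < M" for n i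
    using borel_measurable_diff[OF Xm[OF that] um[OF that]] by simp
  then have diff: "X n - u \<in> L2 \<mu> M" "l2_norm \<mu> M (X n - u) \<le> e n" for n
    using L2_I[OF _ est e_nonneg] by blast+
  have "u = X 0 - (X 0 - u)" by simp
  then have "u \<in> L2 \<mu> M" using L2_inner.V_diff[OF X[of 0] diff(1)[of 0]] by metis
  moreover have "(\<lambda>k. l2_norm \<mu> M (X k - u)) \<longlonglongrightarrow> 0"
  proof (rule tendsto_sandwich[OF _ _ tendsto_const e])
    show "\<forall>\<^sub>F k in sequentially. 0 \<le> l2_norm \<mu> M (X k - u)"
      using L2_inner.nrm_nonneg[OF diff(1)] by (rule always_eventually[OF allI])
    show "\<forall>\<^sub>F k in sequentially. l2_norm \<mu> M (X k - u) \<le> e k"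
      using diff(2) by (rule always_eventually[OF allI])
  qed
  ultimately show ?thesis by blast
qed

interpretation L2_hilbert: semi_hilbert scale "L2 \<mu> M" "l2_inner \<mu> M"
  rewrites "semi_inner.nrm (l2_inner \<mu> M) = l2_norm \<mu> M" for \<mu> M
proof -
  show "semi_hilbert scale (L2 \<mu> M) (l2_inner \<mu> M)"
    by (intro semi_hilbert.intro semi_inner_L2 semi_hilbert_axioms.intro, unfold nrm_L2)
       (rule L2_complete)
qed (rule nrm_L2)


section \<open>Accretive multiplication operators\<close>

text \<open>\<open>Arg\<close> jumps across the negative real axis but its modulus does not; this
  form shows the continuity of the modulus away from the origin.\<close>

lemma abs_Arg_eq_arccos: "z \<noteq> 0 \<Longrightarrow> \<bar>Arg z\<bar> = arccos (Re z / cmod z)"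
proof -
  assume "z \<noteq> 0"
  then have "Re z / cmod z = cos \<bar>Arg z\<bar>"
    by (simp add: cos_Arg)
  moreover have "0 \<le> \<bar>Arg z\<bar>" "\<bar>Arg z\<bar> \<le> pi"
    using mpi_less_Arg[of z] Arg_le_pi[of z] by auto
  ultimately show ?thesis by (simp only: arccos_cos)
qed

lemma abs_Im_le_tan_mult_Re:
  assumes "\<bar>Arg z\<bar> \<le> \<omega>" "\<omega> < pi / 2"
  shows "\<bar>Im z\<bar> \<le> tan \<omega> * Re z"
proof (cases "z = 0")
  case False
  define \<theta> where "\<theta> = Arg z"
  have \<theta>: "\<bar>\<theta>\<bar> \<le> \<omega>" using assms by (simp add: \<theta>_def)
  have z: "Re z = cmod z * cos \<theta>" "Im z = cmod z * sin \<theta>"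
    using rcis_cmod_Arg[of z] Re_rcis[of "cmod z" \<theta>] Im_rcis[of "cmod z" \<theta>] by (simp_all add: \<theta>_def)
  have cos: "cos \<theta> > 0" "cos \<omega> > 0" using \<theta> assms by (auto intro!: cos_gt_zero_pi)
  have "\<bar>sin \<theta>\<bar> = \<bar>tan \<theta>\<bar> * cos \<theta>" using cos by (simp add: tan_def abs_mult)
  also have "\<bar>tan \<theta>\<bar> \<le> tan \<omega>"
  proof -
    have "tan \<theta> \<le> tan \<omega>" "tan (- \<theta>) \<le> tan \<omega>"
      using \<theta> assms by (intro tan_mono_le; linarith)+
    then show ?thesis by simp
  qed
  finally have "\<bar>sin \<theta>\<bar> \<le> tan \<omega> * cos \<theta>" using cos by simp
  then have "cmod z * \<bar>sin \<theta>\<bar> \<le> cmod z * (tan \<omega> * cos \<theta>)" by (intro mult_left_mono) auto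
  then show ?thesis by (simp add: z abs_mult mult_ac)
qed simp

text \<open>Lower semicontinuity of the modulus of \<open>Arg\<close> on the whole plane. At the
  origin the convention \<open>Arg 0 = 0\<close> gives the least possible value, so for
  \<open>a \<ge> 0\<close> the origin is outside the set.\<close>

lemma open_abs_Arg_greater: "open {z. a < \<bar>Arg z\<bar>}"
proof (cases "a < 0")
  case True
  then have "{z. a < \<bar>Arg z\<bar>} = UNIV" by auto
  then show ?thesis by simp
next
  case False
  have "{z. a < \<bar>Arg z\<bar>} = (\<lambda>z. arccos (Re z / cmod z)) -` {a<..} \<inter> - {0}"
  proof (intro set_eqI)
    fix z
    show "z \<in> {z. a < \<bar>Arg z\<bar>} \<longleftrightarrow> z \<in> (\<lambda>z. arccos (Re z / cmod z)) -` {a<..} \<inter> - {0}"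
      using False by (cases "z = 0") (auto simp: abs_Arg_eq_arccos Arg_zero)
  qed
  moreover have "continuous_on (- {0}) (\<lambda>z. arccos (Re z / cmod z))"
  proof (intro continuous_intros ballI)
    fix z :: complex
    have "\<bar>Re z / cmod z\<bar> \<le> 1" using abs_Re_le_cmod[of z] by (simp add: divide_simps)
    then show "-1 \<le> Re z / cmod z \<and> Re z / cmod z \<le> 1" by linarith
  qed auto
  then have "open ((\<lambda>z. arccos (Re z / cmod z)) -` {a<..} \<inter> - {0})"
    using continuous_on_open_vimage[of "- {0 :: complex}" "\<lambda>z. arccos (Re z / cmod z)"]
      open_greaterThan[of a] by (meson open_Compl closed_singleton)
  ultimately show ?thesis by simp
qed

lemma borel_measurable_abs_Arg: "(\<lambda>z. \<bar>Arg z\<bar>) \<in> borel_measurable borel"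
  by (rule borel_measurableI_greater) (simp add: borel_open open_abs_Arg_greater)

lemma continuous_on_sesq: "continuous_on UNIV (sesq M A)"
  unfolding sesq_def by (intro continuous_intros continuous_on_product_coordinates)

lemma open_nonzero_vecs: "open (nonzero_vecs M)"
proof -
  have "nonzero_vecs M = (\<Union>i<M. {v. v i \<noteq> 0})" by (auto simp: nonzero_vecs_def)
  moreover have "open {v :: cvec. v i \<noteq> 0}" for i
    by (intro open_Collect_neq continuous_intros continuous_on_product_coordinates)
  ultimately show ?thesis by auto
qed

text \<open>Since \<open>|Arg|\<close> is lower semicontinuous, a countable dense set of vectors gives the same
  supremum.\<close>

lemma borel_measurable_SUP_abs_Arg_sesq:
  assumes "\<And>i j. \<lbrakk>i < M; j < M\<rbrakk> \<Longrightarrow> (\<lambda>x. B x i j) \<in> borel_measurable \<mu>"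
  shows "(\<lambda>x. SUP v\<in>nonzero_vecs M. ereal \<bar>Arg (sesq M (B x) v)\<bar>) \<in> borel_measurable \<mu>"
proof -
  obtain Q :: "cvec set" where Q: "countable Q" "\<And>X. \<lbrakk>open X; X \<noteq> {}\<rbrakk> \<Longrightarrow> \<exists>d\<in>Q. d \<in> X"
    using countable_dense_exists by blast
  have "(SUP v\<in>nonzero_vecs M. ereal \<bar>Arg (sesq M A v)\<bar>)
      = (SUP v\<in>nonzero_vecs M \<inter> Q. ereal \<bar>Arg (sesq M A v)\<bar>)" (is "?l = ?r") for A
  proof (rule antisym)
    show "?r \<le> ?l" by (intro SUP_subset_mono) auto
    show "?l \<le> ?r"
    proof (intro SUP_least, rule ccontr)
      fix v assume v: "v \<in> nonzero_vecs M" "\<not> ereal \<bar>Arg (sesq M A v)\<bar> \<le> ?r"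
      then have "?r < ereal \<bar>Arg (sesq M A v)\<bar>" by (simp only: not_le)
      then obtain a where a: "?r < ereal a" "ereal a < ereal \<bar>Arg (sesq M A v)\<bar>"
        using ereal_dense2 by blast
      have "open (nonzero_vecs M \<inter> sesq M A -` {z. a < \<bar>Arg z\<bar>})"
        by (intro open_Int open_nonzero_vecs open_vimage open_abs_Arg_greater continuous_on_sesq)
      then obtain d where "d \<in> Q" "d \<in> nonzero_vecs M" "a < \<bar>Arg (sesq M A d)\<bar>"
        using Q(2)[of "nonzero_vecs M \<inter> sesq M A -` {z. a < \<bar>Arg z\<bar>}"] v a by auto
      then have "ereal a < ?r" by (auto simp: less_SUP_iff)
      then show False using a by simp
    qed
  qed
  moreover have "(\<lambda>x. SUP v\<in>nonzero_vecs M \<inter> Q. ereal \<bar>Arg (sesq M (B x) v)\<bar>) \<in> borel_measurable \<mu>"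
  proof (intro borel_measurable_SUP borel_measurable_ereal)
    fix v
    have "(\<lambda>x. sesq M (B x) v) \<in> borel_measurable \<mu>"
      unfolding sesq_def using assms by (auto intro!: borel_measurable_sum borel_measurable_times)
    then show "(\<lambda>x. \<bar>Arg (sesq M (B x) v)\<bar>) \<in> borel_measurable \<mu>"
      by (rule measurable_compose[OF _ borel_measurable_abs_Arg])
  qed (use Q in auto)
  ultimately show ?thesis by simp
qed

section \<open>Bounds for matrices and their quadratic forms\<close>

lemma L_infty_matrix_bound:
  assumes "L_infty_matrix \<mu> M B"
  obtains K where "K > 0" "AE x in \<mu>. \<forall>i<M. \<forall>j<M. cmod (B x i j) \<le> K"
proof -
  have "\<forall>i j. \<exists>K. i < M \<longrightarrow> j < M \<longrightarrow> (AE x in \<mu>. cmod (B x i j) \<le> K)"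
    using assms unfolding L_infty_matrix_def by blast
  then obtain k where k: "\<And>i j. \<lbrakk>i < M; j < M\<rbrakk> \<Longrightarrow> AE x in \<mu>. cmod (B x i j) \<le> k i j" by metis
  define K where "K = 1 + (\<Sum>i<M. \<Sum>j<M. \<bar>k i j\<bar>)"
  have K: "K > 0" unfolding K_def by (intro add_pos_nonneg sum_nonneg) auto
  have le_K: "k i j \<le> K" if "i < M" "j < M" for i j
  proof -
    have "\<bar>k i j\<bar> \<le> (\<Sum>j<M. \<bar>k i j\<bar>)" using that by (intro member_le_sum) auto
    also have "\<dots> \<le> (\<Sum>i<M. \<Sum>j<M. \<bar>k i j\<bar>)"
      using that by (intro member_le_sum[of i "{..<M}" "\<lambda>i. \<Sum>j<M. \<bar>k i j\<bar>"]) (auto intro: sum_nonneg)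
    finally show ?thesis by (simp add: K_def)
  qed
  have "AE x in \<mu>. cmod (B x i j) \<le> K" if "i < M" "j < M" for i j
    using le_K[OF that] by (intro AE_mp[OF k[OF that] AE_I2]) auto
  then have "AE x in \<mu>. \<forall>i\<in>{..<M}. \<forall>j\<in>{..<M}. cmod (B x i j) \<le> K"
    by (intro AE_finite_allI) auto
  then show ?thesis using that[OF K] by (simp add: Ball_def)
qed

lemma sum_squared_le: "(\<Sum>i<M. f i)\<^sup>2 \<le> real M * (\<Sum>i<M. (f i)\<^sup>2)"
  using sum_squared_le_sum_of_squares[of f "{..<M}"] by (simp add: mult.commute)

lemma cmod_mat_vec_le:
  assumes "\<forall>i<M. \<forall>j<M. cmod (A i j) \<le> K" "i < M"
  shows "cmod (\<Sum>j<M. A i j * v j) \<le> K * (\<Sum>j<M. cmod (v j))"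
proof -
  have "cmod (\<Sum>j<M. A i j * v j) \<le> (\<Sum>j<M. K * cmod (v j))"
    using assms by (intro sum_norm_le) (auto simp: norm_mult intro: mult_right_mono)
  then show ?thesis by (simp add: sum_distrib_left)
qed

text \<open>The crude factor \<open>M\<close> is harmless: it serves only to keep the angle away
  from \<open>pi / 2\<close> and never reaches the constants of the theorem.\<close>

lemma norm_sesq_le:
  assumes "\<forall>i<M. \<forall>j<M. cmod (A i j) \<le> K" "K > 0"
  shows "cmod (sesq M A v) \<le> K * real M * (\<Sum>i<M. (cmod (v i))\<^sup>2)"
proof -
  have "cmod (sesq M A v) \<le> (\<Sum>i<M. (K * (\<Sum>j<M. cmod (v j))) * cmod (v i))"
    unfolding sesq_def
    by (intro sum_norm_le) (auto simp: norm_mult intro!: mult_right_mono cmod_mat_vec_le[OF assms(1)])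
  also have "\<dots> = K * (\<Sum>i<M. cmod (v i))\<^sup>2"
    by (simp add: sum_distrib_left[symmetric] power2_eq_square)
  also have "\<dots> \<le> K * (real M * (\<Sum>i<M. (cmod (v i))\<^sup>2))"
    using assms by (intro mult_left_mono sum_squared_le) auto
  finally show ?thesis by (simp add: mult.assoc)
qed

lemma sum_sq_mat_vec_le:
  assumes "\<forall>i<M. \<forall>j<M. cmod (A i j) \<le> K" "K > 0"
  shows "(\<Sum>i<M. (cmod (\<Sum>j<M. A i j * v j))\<^sup>2) \<le> (real M * K)\<^sup>2 * (\<Sum>i<M. (cmod (v i))\<^sup>2)"
proof -
  have "(\<Sum>i<M. (cmod (\<Sum>j<M. A i j * v j))\<^sup>2) \<le> (\<Sum>i<M. (K * (\<Sum>j<M. cmod (v j)))\<^sup>2)"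
    by (intro sum_mono power_mono cmod_mat_vec_le[OF assms(1)]) auto
  also have "\<dots> = real M * K\<^sup>2 * (\<Sum>j<M. cmod (v j))\<^sup>2"
    by (simp add: power_mult_distrib)
  also have "\<dots> \<le> real M * K\<^sup>2 * (real M * (\<Sum>i<M. (cmod (v i))\<^sup>2))"
    by (intro mult_left_mono sum_squared_le) auto
  finally show ?thesis by (simp add: power_mult_distrib power2_eq_square mult_ac)
qed

lemma accretivity_const_AE:
  "AE x in \<mu>. \<forall>v\<in>nonzero_vecs M.
     accretivity_const \<mu> M B \<le> ereal (Re (sesq M (B x) v) / (\<Sum>i<M. (cmod (v i))\<^sup>2))"
  using esssup_AE[where M = \<mu> and f = "\<lambda>x. - (INF v\<in>nonzero_vecs M.
         ereal (Re (sesq M (B x) v) / (\<Sum>i<M. (cmod (v i))\<^sup>2)))"]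
proof (rule AE_mp, intro AE_I2 impI ballI)
  fix x v
  assume *: "- (INF v\<in>nonzero_vecs M. ereal (Re (sesq M (B x) v) / (\<Sum>i<M. (cmod (v i))\<^sup>2)))
      \<le> esssup \<mu> (\<lambda>x. - (INF v\<in>nonzero_vecs M. ereal (Re (sesq M (B x) v) / (\<Sum>i<M. (cmod (v i))\<^sup>2))))"
    and v: "v \<in> nonzero_vecs M"
  have "accretivity_const \<mu> M B \<le> (INF v\<in>nonzero_vecs M. ereal (Re (sesq M (B x) v) / (\<Sum>i<M. (cmod (v i))\<^sup>2)))"
    unfolding accretivity_const_def using * ereal_uminus_le_reorder by blast
  also have "\<dots> \<le> ereal (Re (sesq M (B x) v) / (\<Sum>i<M. (cmod (v i))\<^sup>2))"
    using v by (rule INF_lower)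
  finally show "accretivity_const \<mu> M B \<le> ereal (Re (sesq M (B x) v) / (\<Sum>i<M. (cmod (v i))\<^sup>2))" .
qed

lemma sum_sq_pos: "v \<in> nonzero_vecs M \<Longrightarrow> (\<Sum>i<M. (cmod (v i))\<^sup>2) > 0"
  unfolding nonzero_vecs_def by (auto intro!: sum_pos2)

lemma sesq_sum_sq_eq_0:
  assumes "v \<notin> nonzero_vecs M"
  shows "sesq M A v = 0" "(\<Sum>i<M. (cmod (v i))\<^sup>2) = 0"
  using assms by (auto simp: nonzero_vecs_def sesq_def)

text \<open>On a non-null space some point has a finite quotient, that of the all-ones vector. This
  excludes the value \<infinity>, which \<open>real_of_ereal\<close> would turn into 0.\<close>

lemma accretivity_const_finite:
  assumes "M \<ge> 1" "accretivity_const \<mu> M B > 0" "\<not> (AE x in \<mu>. False)"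
  shows "accretivity_const \<mu> M B = ereal (real_of_ereal (accretivity_const \<mu> M B))"
    "real_of_ereal (accretivity_const \<mu> M B) > 0"
proof -
  have "(\<lambda>_. 1) \<in> nonzero_vecs M" using assms(1) by (auto simp: nonzero_vecs_def intro: exI[of _ 0])
  then have "AE x in \<mu>. accretivity_const \<mu> M B \<noteq> \<infinity>"
    by (intro AE_mp[OF accretivity_const_AE[where \<mu> = \<mu> and B = B and M = M] AE_I2]) force
  then have "accretivity_const \<mu> M B \<noteq> \<infinity>"
    using assms(3) by (cases "accretivity_const \<mu> M B = \<infinity>") auto
  then show "accretivity_const \<mu> M B = ereal (real_of_ereal (accretivity_const \<mu> M B))"
    "real_of_ereal (accretivity_const \<mu> M B) > 0"
    using assms(2) by (cases "accretivity_const \<mu> M B"; simp)+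
qed

text \<open>The cosine of the argument of \<open>z = sesq M (B x) v\<close> is
  \<open>Re z / cmod z\<close>, which accretivity and boundedness keep above a positive constant;
  hence \<omega> is below \<open>pi / 2\<close> and its tangent controls \<open>Im z\<close>. A
  separate \<open>\<beta>'\<close> keeps the constant positive on a null space as well.\<close>

lemma accretive_sector_AE:
  assumes M: "M \<ge> 1" and B: "L_infty_matrix \<mu> M B" and acc: "accretivity_const \<mu> M B > 0"
    and \<omega>: "\<omega> = real_of_ereal (accretivity_angle \<mu> M B)"
  obtains \<beta>' where "0 < \<beta>'" "0 \<le> tan \<omega>"
    "(AE x in \<mu>. False) \<or> \<beta>' = real_of_ereal (accretivity_const \<mu> M B)"
    "AE x in \<mu>. \<forall>v. \<beta>' * (\<Sum>i<M. (cmod (v i))\<^sup>2) \<le> Re (sesq M (B x) v)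
       \<and> \<bar>Im (sesq M (B x) v)\<bar> \<le> tan \<omega> * Re (sesq M (B x) v)"
proof -
  define S where "S v = (\<Sum>i<M. (cmod (v i))\<^sup>2)" for v :: cvec
  define ang where "ang x = (SUP v\<in>nonzero_vecs M. ereal \<bar>Arg (sesq M (B x) v)\<bar>)" for x
  have ang_meas: "ang \<in> borel_measurable \<mu>"
    unfolding ang_def using B by (intro borel_measurable_SUP_abs_Arg_sesq) (auto simp: L_infty_matrix_def)
  have angle: "accretivity_angle \<mu> M B = esssup \<mu> ang"
    by (simp add: accretivity_angle_def ang_def[abs_def])
  show ?thesis
  proof (cases "AE x in \<mu>. False")
    case True
    \<comment> \<open>On a null space the essential supremum is -\<infinity>, which
      \<open>real_of_ereal\<close> maps to 0, and the choice \<open>\<beta>' = 1\<close> is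
      arbitrary.\<close>
    then have "AE x in \<mu>. P x" for P by (rule AE_mp) auto
    moreover from this have "esssup \<mu> ang \<le> -\<infinity>" by (intro esssup_I ang_meas)
    then have "\<omega> = 0" by (simp add: \<omega> angle)
    ultimately show ?thesis using that[of 1] True by simp
  next
    case False
    define \<beta> where "\<beta> = real_of_ereal (accretivity_const \<mu> M B)"
    note \<beta> = accretivity_const_finite[OF M acc False, folded \<beta>_def]
    obtain K where K: "K > 0" "AE x in \<mu>. \<forall>i<M. \<forall>j<M. cmod (B x i j) \<le> K"
      using L_infty_matrix_bound[OF B] .
    have Re_AE: "AE x in \<mu>. \<forall>v. \<beta> * S v \<le> Re (sesq M (B x) v)"
    proof (rule AE_mp[OF accretivity_const_AE[where \<mu> = \<mu> and B = B and M = M]], intro AE_I2 impI allI)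
      fix x v
      assume *: "\<forall>v\<in>nonzero_vecs M. accretivity_const \<mu> M B
        \<le> ereal (Re (sesq M (B x) v) / (\<Sum>i<M. (cmod (v i))\<^sup>2))"
      show "\<beta> * S v \<le> Re (sesq M (B x) v)"
      proof (cases "v \<in> nonzero_vecs M")
        case True
        then have "\<beta> \<le> Re (sesq M (B x) v) / S v"
          using * \<beta>(1) unfolding S_def by (metis ereal_less_eq(3))
        then show ?thesis using sum_sq_pos[OF True] by (simp add: S_def pos_le_divide_eq)
      next
        case False
        then show ?thesis by (simp add: S_def sesq_sum_sq_eq_0)
      qed
    qed
    \<comment> \<open>The cap at 1 keeps \<open>r\<close> in the range where \<open>arccos\<close>
      is antitone; positivity of \<open>r\<close> gives
      \<open>arccos r < arccos 0 = pi / 2\<close>.\<close>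
    define r where "r = min 1 (\<beta> / (K * real M))"
    have r: "0 < r" "r \<le> 1" using K M \<beta> by (auto simp: r_def)
    have "AE x in \<mu>. ang x \<le> ereal (arccos r)"
      using Re_AE K(2)
    proof (rule AE_mp[OF _ AE_mp[OF _ AE_I2]], intro impI)
      fix x
      assume re: "\<forall>v. \<beta> * S v \<le> Re (sesq M (B x) v)" and bd: "\<forall>i<M. \<forall>j<M. cmod (B x i j) \<le> K"
      show "ang x \<le> ereal (arccos r)"
        unfolding ang_def
      proof (rule SUP_least)
        fix v assume v: "v \<in> nonzero_vecs M"
        define z where "z = sesq M (B x) v"
        have S: "S v > 0" using sum_sq_pos[OF v] by (simp add: S_def)
        have re_z: "\<beta> * S v \<le> Re z" using re by (simp add: z_def)
        then have "Re z > 0" using S \<beta>(2) mult_pos_pos[of \<beta> "S v"] by linarith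
        then have z: "z \<noteq> 0" by auto
        have "cmod z \<le> K * real M * S v"
          using norm_sesq_le[OF bd K(1)] by (simp add: z_def S_def)
        then have "\<beta> / (K * real M) * cmod z \<le> \<beta> / (K * real M) * (K * real M * S v)"
          using K \<beta> by (intro mult_left_mono) auto
        also have "\<dots> = \<beta> * S v" using K M by simp
        also have "\<dots> \<le> Re z" by (rule re_z)
        finally have "\<beta> / (K * real M) \<le> Re z / cmod z" using z by (simp add: pos_le_divide_eq)
        then have "r \<le> Re z / cmod z" by (simp add: r_def)
        moreover have "Re z / cmod z \<le> 1" using complex_Re_le_cmod[of z] z by simp
        ultimately have "\<bar>Arg z\<bar> \<le> arccos r"
          unfolding abs_Arg_eq_arccos[OF z] using r by (intro arccos_le_arccos) auto
        then show "ereal \<bar>Arg (sesq M (B x) v)\<bar> \<le> ereal (arccos r)" by (simp add: z_def)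
      qed
    qed
    then have up: "esssup \<mu> ang \<le> ereal (arccos r)" by (intro esssup_I ang_meas)
    \<comment> \<open>A lower bound excludes -\<infinity>, so that the essential supremum is real
      and \<open>real_of_ereal\<close> preserves it.\<close>
    have "0 \<le> ang x" for x
    proof -
      have "(\<lambda>_. 1) \<in> nonzero_vecs M" using M by (auto simp: nonzero_vecs_def intro: exI[of _ 0])
      then have "ereal \<bar>Arg (sesq M (B x) (\<lambda>_. 1))\<bar> \<le> ang x" unfolding ang_def by (rule SUP_upper)
      then show ?thesis by (rule order_trans[rotated]) simp
    qed
    then have "AE x in \<mu>. 0 \<le> esssup \<mu> ang"
      by (intro AE_mp[OF esssup_AE[where M = \<mu> and f = ang] AE_I2]) (blast intro: order_trans)
    then have low: "0 \<le> esssup \<mu> ang" using False by (cases "0 \<le> esssup \<mu> ang") auto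
    have ess: "esssup \<mu> ang = ereal \<omega>"
      using up low unfolding \<omega> angle by (cases "esssup \<mu> ang") auto
    have "\<omega> \<le> arccos r" using up by (simp add: ess)
    also have "arccos r < arccos 0" using r by (intro arccos_less_arccos) auto
    finally have \<omega>2: "\<omega> < pi / 2" by simp
    have \<omega>0: "0 \<le> \<omega>" using low by (simp add: ess)
    have "AE x in \<mu>. \<forall>v. \<bar>Im (sesq M (B x) v)\<bar> \<le> tan \<omega> * Re (sesq M (B x) v)"
    proof (rule AE_mp[OF esssup_AE[where M = \<mu> and f = ang]], intro AE_I2 impI allI)
      fix x v assume *: "ang x \<le> esssup \<mu> ang"
      show "\<bar>Im (sesq M (B x) v)\<bar> \<le> tan \<omega> * Re (sesq M (B x) v)"
      proof (cases "v \<in> nonzero_vecs M")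
        case True
        then have "ereal \<bar>Arg (sesq M (B x) v)\<bar> \<le> ang x" unfolding ang_def by (rule SUP_upper)
        then have "\<bar>Arg (sesq M (B x) v)\<bar> \<le> \<omega>" using * ess by (simp add: order_trans)
          (metis ereal_less_eq(3) order_trans)
        then show ?thesis using \<omega>2 by (rule abs_Im_le_tan_mult_Re)
      next
        case False
        then show ?thesis by (simp add: sesq_sum_sq_eq_0)
      qed
    qed
    with Re_AE have "AE x in \<mu>. \<forall>v. \<beta> * S v \<le> Re (sesq M (B x) v)
       \<and> \<bar>Im (sesq M (B x) v)\<bar> \<le> tan \<omega> * Re (sesq M (B x) v)" by eventually_elim blast
    then show ?thesis
      using that[of \<beta>] \<beta>(2) tan_pos_pi2_le[OF \<omega>0 \<omega>2] unfolding S_def \<beta>_def by blast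
  qed
qed

text \<open>The sector is a convex cone, so the pointwise conditions survive integration: the
  modulus of the integral of \<open>Im p\<close> is at most the integral of its modulus.\<close>

lemma mult_op_accretive:
  assumes B: "AE x in \<mu>. \<forall>v. \<beta> * (\<Sum>i<M. (cmod (v i))\<^sup>2) \<le> Re (sesq M (B x) v)
       \<and> \<bar>Im (sesq M (B x) v)\<bar> \<le> \<kappa> * Re (sesq M (B x) v)"
    and uf: "(u, f) \<in> mult_op \<mu> M B"
  shows "\<beta> * (l2_norm \<mu> M u)\<^sup>2 \<le> Re (l2_inner \<mu> M f u)"
    and "\<bar>Im (l2_inner \<mu> M f u)\<bar> \<le> \<kappa> * Re (l2_inner \<mu> M f u)"
proof -
  have u: "u \<in> L2 \<mu> M" and f: "f \<in> L2 \<mu> M"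
    and eq: "AE x in \<mu>. \<forall>i<M. f x i = (\<Sum>j<M. B x i j * u x j)"
    using uf by (auto simp: mult_op_def ae_eq_def)
  define p where "p x = (\<Sum>i<M. f x i * cnj (u x i))" for x
  have p: "integrable \<mu> p"
    unfolding p_def[abs_def] by (intro Bochner_Integration.integrable_sum L2_integrable_inner[OF f u]) simp
  have ip: "l2_inner \<mu> M f u = (LINT x|\<mu>. p x)" by (simp add: l2_inner_def p_def)
  have pw: "AE x in \<mu>. \<beta> * (\<Sum>i<M. (cmod (u x i))\<^sup>2) \<le> Re (p x) \<and> \<bar>Im (p x)\<bar> \<le> \<kappa> * Re (p x)"
    using B eq
  proof eventually_elim
    case (elim x)
    then have "p x = sesq M (B x) (u x)" by (simp add: p_def sesq_def)
    then show ?case using elim(1) by simp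
  qed
  have Re: "Re (LINT x|\<mu>. p x) = (LINT x|\<mu>. Re (p x))" and Im: "Im (LINT x|\<mu>. p x) = (LINT x|\<mu>. Im (p x))"
    using p by simp_all
  have "\<beta> * (l2_norm \<mu> M u)\<^sup>2 = (LINT x|\<mu>. \<beta> * (\<Sum>i<M. (cmod (u x i))\<^sup>2))"
    using L2_inner.nrm_sq[OF u] by (simp add: l2_inner_self)
  also have "\<dots> \<le> (LINT x|\<mu>. Re (p x))"
    using p L2_integrable_norm[OF u] pw by (intro integral_mono_AE) auto
  finally show "\<beta> * (l2_norm \<mu> M u)\<^sup>2 \<le> Re (l2_inner \<mu> M f u)" by (simp only: ip Re)
  have "\<bar>LINT x|\<mu>. Im (p x)\<bar> \<le> (LINT x|\<mu>. \<bar>Im (p x)\<bar>)" by (rule integral_abs_bound)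
  also have "\<dots> \<le> (LINT x|\<mu>. \<kappa> * Re (p x))"
    using p pw by (intro integral_mono_AE) auto
  finally show "\<bar>Im (l2_inner \<mu> M f u)\<bar> \<le> \<kappa> * Re (l2_inner \<mu> M f u)" using p by (simp add: ip)
qed

lemma mult_op_cong:
  assumes "(u, f) \<in> mult_op \<mu> M B" "v \<in> L2 \<mu> M" "g \<in> L2 \<mu> M" "ae_eq \<mu> M u v" "ae_eq \<mu> M f g"
  shows "(v, g) \<in> mult_op \<mu> M B"
proof -
  have "ae_eq \<mu> M f (\<lambda>x i. \<Sum>j<M. B x i j * u x j)" using assms(1) by (simp add: mult_op_def)
  then have "ae_eq \<mu> M g (\<lambda>x i. \<Sum>j<M. B x i j * v x j)"
    using assms(4,5) unfolding ae_eq_def by eventually_elim simp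
  then show ?thesis using assms(2,3) by (simp add: mult_op_def)
qed

lemma lin_rel_mult_op: "L2_inner.lin_rel \<mu> M (mult_op \<mu> M B)"
proof -
  have "(u + v, f + g) \<in> mult_op \<mu> M B"
    if "(u, f) \<in> mult_op \<mu> M B" "(v, g) \<in> mult_op \<mu> M B" for u v f g
  proof -
    have "ae_eq \<mu> M f (\<lambda>x i. \<Sum>j<M. B x i j * u x j)" "ae_eq \<mu> M g (\<lambda>x i. \<Sum>j<M. B x i j * v x j)"
      using that by (auto simp: mult_op_def)
    then have "ae_eq \<mu> M (f + g) (\<lambda>x i. \<Sum>j<M. B x i j * (u + v) x j)"
      unfolding ae_eq_def by eventually_elim (simp add: distrib_left sum.distrib)
    then show ?thesis using that by (auto simp: mult_op_def)
  qed
  moreover have "(scale c u, scale c f) \<in> mult_op \<mu> M B" if "(u, f) \<in> mult_op \<mu> M B" for c u f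
  proof -
    have "ae_eq \<mu> M f (\<lambda>x i. \<Sum>j<M. B x i j * u x j)" using that by (auto simp: mult_op_def)
    then have "ae_eq \<mu> M (scale c f) (\<lambda>x i. \<Sum>j<M. B x i j * scale c u x j)"
      unfolding ae_eq_def by eventually_elim (simp add: scale_def sum_distrib_left mult_ac)
    then show ?thesis using that by (auto simp: mult_op_def)
  qed
  moreover have "(0, 0) \<in> mult_op \<mu> M B" by (simp add: mult_op_def ae_eq_def)
  moreover have "mult_op \<mu> M B \<subseteq> L2 \<mu> M \<times> L2 \<mu> M" by (auto simp: mult_op_def)
  ultimately show ?thesis unfolding L2_inner.lin_rel_def by blast
qed

lemma mult_op_total_bounded:
  assumes B: "L_infty_matrix \<mu> M B"
  shows "Domain (mult_op \<mu> M B) = L2 \<mu> M"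
    and "\<exists>K. \<forall>(u, f)\<in>mult_op \<mu> M B. l2_norm \<mu> M f \<le> K * l2_norm \<mu> M u"
proof -
  obtain K where K: "K > 0" "AE x in \<mu>. \<forall>i<M. \<forall>j<M. cmod (B x i j) \<le> K"
    using L_infty_matrix_bound[OF B] .
  define Bu where "Bu u x i = (\<Sum>j<M. B x i j * u x j)" for u :: field and x i
  have Bu: "Bu u \<in> L2 \<mu> M \<and> l2_norm \<mu> M (Bu u) \<le> real M * K * l2_norm \<mu> M u" if u: "u \<in> L2 \<mu> M" for u
  proof -
    have meas: "(\<lambda>x. Bu u x i) \<in> borel_measurable \<mu>" if "i < M" for i
      unfolding Bu_def using B L2_measurable[OF u] that
      by (auto simp: L_infty_matrix_def intro!: borel_measurable_sum borel_measurable_times)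
    have "(\<integral>\<^sup>+x. ennreal (\<Sum>i<M. (cmod (Bu u x i))\<^sup>2) \<partial>\<mu>)
        \<le> (\<integral>\<^sup>+x. ennreal ((real M * K)\<^sup>2) * ennreal (\<Sum>i<M. (cmod (u x i))\<^sup>2) \<partial>\<mu>)"
    proof (rule nn_integral_mono_AE, use K(2) in eventually_elim)
      case (elim x)
      then show ?case
        using sum_sq_mat_vec_le[OF elim K(1), of "u x"] unfolding Bu_def
        by (subst ennreal_mult[symmetric]) (auto intro!: ennreal_leI sum_nonneg)
    qed
    also have "\<dots> = ennreal ((real M * K)\<^sup>2) * ennreal ((l2_norm \<mu> M u)\<^sup>2)"
      using L2_measurable[OF u] unfolding nn_integral_eq_l2_norm[OF u, symmetric]
      by (intro nn_integral_cmult) (auto intro!: measurable_compose[OF _ measurable_ennreal]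
          borel_measurable_sum borel_measurable_power borel_measurable_norm)
    also have "\<dots> = ennreal ((real M * K * l2_norm \<mu> M u)\<^sup>2)"
      by (simp add: ennreal_mult[symmetric] power_mult_distrib)
    finally show ?thesis
      using L2_I[OF meas, where c = "real M * K * l2_norm \<mu> M u"] K(1) L2_inner.nrm_nonneg[OF u] by simp
  qed
  have uBu: "(u, Bu u) \<in> mult_op \<mu> M B" if "u \<in> L2 \<mu> M" for u
    using Bu[OF that] that by (simp add: mult_op_def ae_eq_def Bu_def)
  then show "Domain (mult_op \<mu> M B) = L2 \<mu> M" by (auto simp: mult_op_def Domain_iff)
  have "l2_norm \<mu> M f \<le> real M * K * l2_norm \<mu> M u" if "(u, f) \<in> mult_op \<mu> M B" for u f
  proof -
    have *: "u \<in> L2 \<mu> M" "f \<in> L2 \<mu> M" "ae_eq \<mu> M f (Bu u)"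
      using that by (auto simp: mult_op_def Bu_def[abs_def])
    then have "l2_norm \<mu> M f = l2_norm \<mu> M (Bu u)"
      using Bu[OF *(1)] by (intro L2_inner.nrm_cong) (auto simp: ae_eq_iff_l2_norm)
    then show ?thesis using Bu[OF *(1)] by simp
  qed
  then show "\<exists>K. \<forall>(u, f)\<in>mult_op \<mu> M B. l2_norm \<mu> M f \<le> K * l2_norm \<mu> M u" by blast
qed


section \<open>The resolvent of DB\<close>

lemma lin_rel_operator_in: "operator_in \<mu> M (L2 \<mu> M) T \<Longrightarrow> L2_inner.lin_rel \<mu> M T"
  by (simp add: operator_in_def L2_inner.lin_rel_def)

lemma lin_rel_relcomp:
  assumes S: "L2_inner.lin_rel \<mu> M S" and T: "L2_inner.lin_rel \<mu> M T"
  shows "L2_inner.lin_rel \<mu> M (S O T)"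
  unfolding L2_inner.lin_rel_def
proof (intro conjI allI impI)
  show "S O T \<subseteq> L2 \<mu> M \<times> L2 \<mu> M"
    using L2_inner.lin_rel_V(1)[OF S] L2_inner.lin_rel_V(2)[OF T] by fast
  show "(0, 0) \<in> S O T"
    using L2_inner.lin_rel_0[OF S] L2_inner.lin_rel_0[OF T] by (rule relcompI)
next
  fix u f v g assume "(u, f) \<in> S O T" "(v, g) \<in> S O T"
  then obtain w z where "(u, w) \<in> S" "(v, z) \<in> S" "(w, f) \<in> T" "(z, g) \<in> T" by (elim relcompEpair)
  then show "(u + v, f + g) \<in> S O T"
    by (intro relcompI[OF L2_inner.lin_rel_add[OF S] L2_inner.lin_rel_add[OF T]])
next
  fix c u f assume "(u, f) \<in> S O T"
  then obtain w where "(u, w) \<in> S" "(w, f) \<in> T" by (elim relcompEpair)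
  then show "(scale c u, scale c f) \<in> S O T"
    by (intro relcompI[OF L2_inner.lin_rel_scale[OF S] L2_inner.lin_rel_scale[OF T]])
qed

lemma adj_eq_adjoint_op: "L2_inner.adj \<mu> M T = adjoint_op \<mu> M T"
  unfolding L2_inner.adj_def adjoint_op_def ..

text \<open>\<open>op_norm\<close> is a supremum of reals and informative only for a set bounded
  above; some bound \<open>K\<close> is therefore required first. It also settles vectors of norm
  zero, which cannot be normalized.\<close>

lemma op_norm_bound:
  assumes T: "L2_inner.lin_rel \<mu> M T"
    and bd: "\<And>u f. (u, f) \<in> T \<Longrightarrow> l2_norm \<mu> M f \<le> K * l2_norm \<mu> M u"
  shows "0 \<le> op_norm \<mu> M T"
    and "(u, f) \<in> T \<Longrightarrow> l2_norm \<mu> M f \<le> op_norm \<mu> M T * l2_norm \<mu> M u"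
proof -
  define X where "X = {l2_norm \<mu> M f | u f. (u, f) \<in> T \<and> l2_norm \<mu> M u \<le> 1}"
  have X: "op_norm \<mu> M T = Sup X" by (simp add: op_norm_def X_def)
  have bdd: "bdd_above X"
  proof (rule bdd_aboveI)
    fix y assume "y \<in> X"
    then obtain u f where uf: "(u, f) \<in> T" "l2_norm \<mu> M u \<le> 1" "y = l2_norm \<mu> M f"
      by (auto simp: X_def)
    have n: "0 \<le> l2_norm \<mu> M u"
      using L2_inner.lin_rel_V(1)[OF T uf(1)] by (rule L2_inner.nrm_nonneg)
    have "y \<le> K * l2_norm \<mu> M u" using bd uf by simp
    also have "\<dots> \<le> \<bar>K\<bar> * 1" using uf(2) n by (intro mult_mono) auto
    finally show "y \<le> \<bar>K\<bar>" by simp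
  qed
  have "l2_norm \<mu> M 0 \<in> X"
    unfolding X_def using L2_inner.lin_rel_0[OF T] L2_inner.nrm_zero[of \<mu> M] by force
  then show "0 \<le> op_norm \<mu> M T"
    unfolding X using cSup_upper[OF _ bdd] L2_inner.nrm_zero[of \<mu> M] by metis
  assume uf: "(u, f) \<in> T"
  have V: "u \<in> L2 \<mu> M" "f \<in> L2 \<mu> M" using L2_inner.lin_rel_V[OF T uf] .
  define n where "n = l2_norm \<mu> M u"
  show "l2_norm \<mu> M f \<le> op_norm \<mu> M T * l2_norm \<mu> M u"
  proof (cases "n = 0")
    case True
    then show ?thesis using bd[OF uf] by (simp add: n_def)
  next
    case False
    then have n: "n > 0" using L2_inner.nrm_nonneg[OF V(1)] by (simp add: n_def)
    have sc: "cmod (complex_of_real (1 / n)) = 1 / n" unfolding norm_of_real using n by simp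
    have "l2_norm \<mu> M (scale (complex_of_real (1 / n)) f) \<in> X"
      unfolding X_def using L2_inner.lin_rel_scale[OF T uf, of "complex_of_real (1 / n)"]
        L2_inner.nrm_scale[OF V(1), of "complex_of_real (1 / n)", unfolded sc] n
      by (force simp: n_def)
    then have "l2_norm \<mu> M (scale (complex_of_real (1 / n)) f) \<le> op_norm \<mu> M T"
      unfolding X by (rule cSup_upper[OF _ bdd])
    then have "l2_norm \<mu> M f / n \<le> op_norm \<mu> M T"
      using L2_inner.nrm_scale[OF V(2), of "complex_of_real (1 / n)", unfolded sc] by simp
    then show ?thesis using n by (simp add: n_def[symmetric] pos_divide_le_eq)
  qed
qed

lemma op_norm_le:
  assumes "(0, 0) \<in> T" "0 \<le> c" and "\<And>u f. (u, f) \<in> T \<Longrightarrow> l2_norm \<mu> M f \<le> c * l2_norm \<mu> M u"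
  shows "op_norm \<mu> M T \<le> c"
  unfolding op_norm_def
proof (rule cSup_least)
  show "{l2_norm \<mu> M f |u f. (u, f) \<in> T \<and> l2_norm \<mu> M u \<le> 1} \<noteq> {}"
    using assms(1) L2_inner.nrm_zero[of \<mu> M] by force
next
  fix y assume "y \<in> {l2_norm \<mu> M f |u f. (u, f) \<in> T \<and> l2_norm \<mu> M u \<le> 1}"
  then obtain u f where uf: "(u, f) \<in> T" "l2_norm \<mu> M u \<le> 1" "y = l2_norm \<mu> M f" by auto
  have "y \<le> c * l2_norm \<mu> M u" using assms(3) uf by simp
  also have "\<dots> \<le> c * 1" using assms(2) uf(2) by (intro mult_left_mono) auto
  finally show "y \<le> c" by simp
qed

lemma op_norm_null:
  assumes "AE x in \<mu>. False" "(0, 0) \<in> T"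
  shows "op_norm \<mu> M T = 0"
proof -
  have "l2_norm \<mu> M u = 0" for u
  proof -
    have "(LINT x|\<mu>. (\<Sum>i<M. (cmod (u x i))\<^sup>2)) = 0"
      using assms(1) by (intro integral_eq_zero_AE) auto
    then show ?thesis by (simp add: l2_norm_def)
  qed
  then have "{l2_norm \<mu> M f |u f. (u, f) \<in> T \<and> l2_norm \<mu> M u \<le> 1} = {0}"
    using assms(2) by auto
  then show ?thesis by (simp add: op_norm_def)
qed

lemma resolvent_iff: "(F, u) \<in> resolvent l T \<longleftrightarrow> (u, scale l u - F) \<in> T"
proof
  assume "(F, u) \<in> resolvent l T"
  then show "(u, scale l u - F) \<in> T" by (auto simp: resolvent_def)
next
  assume "(u, scale l u - F) \<in> T"
  moreover have "F = scale l u - (scale l u - F)" by simp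
  ultimately show "(F, u) \<in> resolvent l T" unfolding resolvent_def by blast
qed

text \<open>The bound \<open>bd\<close>, applied to the difference of two preimages of the same
  \<open>F\<close>, shows that they agree almost everywhere. An error of norm zero in
  \<open>surj\<close> is moved into the value of \<open>T\<close> by \<open>cong\<close>, which
  places \<open>F\<close> exactly in the domain.\<close>

lemma bounded_operator_resolvent:
  assumes T: "L2_inner.lin_rel \<mu> M T"
    and cong: "\<And>u f v g. \<lbrakk>(u, f) \<in> T; v \<in> L2 \<mu> M; g \<in> L2 \<mu> M; ae_eq \<mu> M u v; ae_eq \<mu> M f g\<rbrakk>
      \<Longrightarrow> (v, g) \<in> T"
    and surj: "\<And>F. F \<in> L2 \<mu> M \<Longrightarrow> \<exists>u f. (u, f) \<in> T \<and> l2_norm \<mu> M (scale l u - f - F) = 0"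
    and bd: "\<And>u f. (u, f) \<in> T \<Longrightarrow> l2_norm \<mu> M u \<le> K * l2_norm \<mu> M (scale l u - f)"
  shows "bounded_operator \<mu> M (L2 \<mu> M) (resolvent l T)"
proof -
  let ?R = "resolvent l T"
  note V = L2_inner.lin_rel_V[OF T]
  have sub: "?R \<subseteq> L2 \<mu> M \<times> L2 \<mu> M"
    using V unfolding resolvent_def by blast
  have bdR: "l2_norm \<mu> M u \<le> K * l2_norm \<mu> M F" if "(F, u) \<in> ?R" for F u
    using that bd by (auto simp: resolvent_def)
  have lin: "L2_inner.lin_rel \<mu> M ?R"
    unfolding L2_inner.lin_rel_def
  proof (intro conjI allI impI sub)
    show "(0, 0) \<in> ?R"
      using L2_inner.lin_rel_0[OF T] by (simp add: resolvent_iff L2_inner.scale_zero_right)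
  next
    fix F u G v assume "(F, u) \<in> ?R" "(G, v) \<in> ?R"
    then have "(u + v, (scale l u - F) + (scale l v - G)) \<in> T"
      unfolding resolvent_iff by (rule L2_inner.lin_rel_add[OF T])
    moreover have "(scale l u - F) + (scale l v - G) = scale l (u + v) - (F + G)"
      by (simp add: L2_inner.scale_right_distrib)
    ultimately show "(F + G, u + v) \<in> ?R" by (simp add: resolvent_iff)
  next
    fix c F u assume "(F, u) \<in> ?R"
    then have "(scale c u, scale c (scale l u - F)) \<in> T"
      unfolding resolvent_iff by (rule L2_inner.lin_rel_scale[OF T])
    moreover have "scale c (scale l u - F) = scale l (scale c u) - scale c F"
      by (simp add: L2_inner.scale_right_diff_distrib mult.commute)
    ultimately show "(scale c F, scale c u) \<in> ?R" by (simp add: resolvent_iff)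
  qed
  have "operator_in \<mu> M (L2 \<mu> M) ?R"
    unfolding operator_in_def
  proof (intro conjI allI impI sub)
    fix F u G v
    assume R: "(F, u) \<in> ?R" and GL: "G \<in> L2 \<mu> M" and vL: "v \<in> L2 \<mu> M"
      and "ae_eq \<mu> M F G" "ae_eq \<mu> M u v"
    then have "ae_eq \<mu> M (scale l u - F) (scale l v - G)"
      unfolding ae_eq_def by (auto simp: scale_def elim: eventually_elim2)
    then show "(G, v) \<in> ?R"
      using R GL vL \<open>ae_eq \<mu> M u v\<close> cong[of u "scale l u - F" v "scale l v - G"]
      unfolding resolvent_iff by (simp add: L2_inner.V_diff L2_inner.V_scale)
  next
    fix F u v assume R: "(F, u) \<in> ?R" "(F, v) \<in> ?R"
    then have L: "u \<in> L2 \<mu> M" "v \<in> L2 \<mu> M" using sub by blast+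
    have "(0, u - v) \<in> ?R" using L2_inner.lin_rel_diff[OF lin R] by simp
    then have "l2_norm \<mu> M (u - v) \<le> K * l2_norm \<mu> M 0" by (rule bdR)
    then have "l2_norm \<mu> M (u - v) = 0"
      using L2_inner.nrm_nonneg[OF L2_inner.V_diff[OF L]] L2_inner.nrm_zero[of \<mu> M] by simp
    then show "ae_eq \<mu> M u v" using ae_eq_iff_l2_norm[OF L] by simp
  qed (use lin in \<open>auto simp: L2_inner.lin_rel_def\<close>)
  moreover have "Domain ?R = L2 \<mu> M"
  proof (intro equalityI subsetI)
    fix F assume F: "F \<in> L2 \<mu> M"
    then obtain u f where uf: "(u, f) \<in> T" "l2_norm \<mu> M (scale l u - f - F) = 0"
      using surj by blast
    have L: "u \<in> L2 \<mu> M" "f \<in> L2 \<mu> M" "scale l u - F \<in> L2 \<mu> M"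
      using V[OF uf(1)] F by (auto intro: L2_inner.V_diff L2_inner.V_scale)
    have "l2_norm \<mu> M (scale l u - F - f) = 0" using uf(2) by (simp add: algebra_simps)
    then have "ae_eq \<mu> M f (scale l u - F)"
      using L2_inner.nrm_diff_commute[OF L(2,3)] ae_eq_iff_l2_norm[OF L(2,3)] by simp
    moreover have "ae_eq \<mu> M u u" by (simp add: ae_eq_def)
    ultimately have "(u, scale l u - F) \<in> T" using cong[OF uf(1) L(1,3)] by blast
    then show "F \<in> Domain ?R" using resolvent_iff by blast
  qed (use sub in blast)
  ultimately show ?thesis unfolding bounded_operator_def using bdR by blast
qed

text \<open>The point \<open>p\<close> lies vertically below or above \<open>l\<close> on the
  boundary of the sector, at distance \<delta>. Positivity matters because the distance becomes a
  denominator, and division by zero would give 0.\<close>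

lemma infdist_closed_sector:
  assumes "0 \<le> tan \<omega>" and \<delta>: "\<delta> = \<bar>Im l\<bar> - \<bar>Re l\<bar> * tan \<omega>" "0 < \<delta>"
  shows "0 < infdist l (closed_sector \<omega>)" "infdist l (closed_sector \<omega>) \<le> \<delta>"
proof -
  define p where "p = Complex (Re l) (sgn (Im l) * (\<bar>Re l\<bar> * tan \<omega>))"
  have "0 \<le> \<bar>Re l\<bar> * tan \<omega>" using assms(1) by simp
  then have Im: "\<bar>sgn (Im l)\<bar> = 1" "Im l = sgn (Im l) * \<bar>Im l\<bar>"
    using \<delta> by (auto simp: sgn_if)
  have p: "p \<in> closed_sector \<omega>"
    using assms(1) Im by (simp add: closed_sector_def p_def abs_mult)
  have "l - p = Complex 0 (sgn (Im l) * \<delta>)"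
    by (simp add: complex_eq_iff p_def \<delta>(1) right_diff_distrib Im(2)[symmetric])
  then have "dist l p = \<delta>" using \<delta> Im by (simp add: dist_norm cmod_def abs_mult)
  then show "infdist l (closed_sector \<omega>) \<le> \<delta>" using infdist_le[OF p, of l] by simp
  have "closed (closed_sector \<omega>)"
    unfolding closed_sector_def by (intro closed_Collect_le continuous_intros)
  moreover have "l \<notin> closed_sector \<omega>" using \<delta> by (auto simp: closed_sector_def)
  ultimately have "infdist l (closed_sector \<omega>) \<noteq> 0"
    using in_closed_iff_infdist_zero[of "closed_sector \<omega>" l] p by blast
  then show "0 < infdist l (closed_sector \<omega>)" using infdist_nonneg[of l "closed_sector \<omega>"] by simp
qed

text \<open>If \<open>\<mu>\<close> is null (\<open>\<Omega>\<close> may be empty), the accretivity constant is \<open>\<infinity>\<close>, hence \<open>\<beta> = 0\<close>; all norms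
  vanish then, and the bounds on \<open>t\<close> and \<open>c\<close> are not needed.\<close>

lemma resolvent_mult_op_comp:
  fixes a b \<beta> \<omega> t :: real
  assumes M: "M \<ge> 1" and B: "L_infty_matrix \<mu> M B"
    and acc: "accretivity_const \<mu> M B > 0"
    and \<beta>: "\<beta> = real_of_ereal (accretivity_const \<mu> M B)"
    and \<omega>: "\<omega> = real_of_ereal (accretivity_angle \<mu> M B)"
    and D: "operator_in \<mu> M (L2 \<mu> M) D" "D = op_add D1 D0"
    and D0: "bounded_operator \<mu> M (L2 \<mu> M) D0" and D1: "self_adjoint \<mu> M D1"
    and a: "a = op_norm \<mu> M (mult_op \<mu> M B O D0)" and b: "b = op_norm \<mu> M (mult_op \<mu> M B)"
    and t: "0 < t" "\<beta> > 0 \<Longrightarrow> 2 * (a * b) \<le> t * \<beta>"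
    and c: "0 < c" "\<beta> > 0 \<Longrightarrow> 2 * b \<le> c * \<beta>"
    and l: "l \<notin> sector \<omega> t"
  shows "l \<in> resolvent_set \<mu> M (L2 \<mu> M) (mult_op \<mu> M B O D)"
    and "op_norm \<mu> M (resolvent l (mult_op \<mu> M B O D)) \<le> c / infdist l (closed_sector \<omega>)"
proof -
  let ?B = "mult_op \<mu> M B" and ?T = "mult_op \<mu> M B O D"
  have linB: "L2_inner.lin_rel \<mu> M ?B" by (rule lin_rel_mult_op)
  have linD0: "L2_inner.lin_rel \<mu> M D0" using D0 by (simp add: bounded_operator_def lin_rel_operator_in)
  have linD1: "L2_inner.lin_rel \<mu> M D1" using D1 by (simp add: self_adjoint_def lin_rel_operator_in)
  have linD: "L2_inner.lin_rel \<mu> M D" using D(1) by (rule lin_rel_operator_in)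
  have linBD0: "L2_inner.lin_rel \<mu> M (?B O D0)" using linB linD0 by (rule lin_rel_relcomp)
  have linT: "L2_inner.lin_rel \<mu> M ?T" using linB linD by (rule lin_rel_relcomp)
  obtain K where K: "\<And>u f. (u, f) \<in> ?B \<Longrightarrow> l2_norm \<mu> M f \<le> K * l2_norm \<mu> M u"
    using mult_op_total_bounded(2)[OF B] by blast
  have D0_bounded: "\<exists>K. \<forall>(u, f)\<in>D0. l2_norm \<mu> M f \<le> K * l2_norm \<mu> M u"
    using D0 by (simp add: bounded_operator_def)
  then obtain K0 where K0: "\<And>u f. (u, f) \<in> D0 \<Longrightarrow> l2_norm \<mu> M f \<le> K0 * l2_norm \<mu> M u"
    by blast
  \<comment> \<open>This bound only makes the operator norm \<open>a\<close> of the product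
    meaningful; the constants are expressed through \<open>a\<close> itself.\<close>
  have KK0: "l2_norm \<mu> M f \<le> (\<bar>K0\<bar> * K) * l2_norm \<mu> M u" if uf: "(u, f) \<in> ?B O D0" for u f
  proof -
    obtain w where w: "(u, w) \<in> ?B" "(w, f) \<in> D0" using uf by blast
    have "0 \<le> l2_norm \<mu> M w"
      using L2_inner.lin_rel_V(2)[OF linB w(1)] by (rule L2_inner.nrm_nonneg)
    then have "K0 * l2_norm \<mu> M w \<le> \<bar>K0\<bar> * l2_norm \<mu> M w" by (intro mult_right_mono) auto
    also have "\<dots> \<le> \<bar>K0\<bar> * (K * l2_norm \<mu> M u)" using K[OF w(1)] by (intro mult_left_mono) auto
    finally show ?thesis using K0[OF w(2)] by simp
  qed
  obtain \<beta>' where \<beta>': "0 < \<beta>'" "0 \<le> tan \<omega>" "(AE x in \<mu>. False) \<or> \<beta>' = \<beta>"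
    and sec: "AE x in \<mu>. \<forall>v. \<beta>' * (\<Sum>i<M. (cmod (v i))\<^sup>2) \<le> Re (sesq M (B x) v)
       \<and> \<bar>Im (sesq M (B x) v)\<bar> \<le> tan \<omega> * Re (sesq M (B x) v)"
    using accretive_sector_AE[OF M B acc \<omega>] unfolding \<beta> .
  have ab_null: "a = 0 \<and> b = 0" if "AE x in \<mu>. False"
    unfolding a b using that L2_inner.lin_rel_0[OF linBD0] L2_inner.lin_rel_0[OF linB]
    by (simp add: op_norm_null)
  have B_le: "l2_norm \<mu> M f \<le> b * l2_norm \<mu> M u" if "(u, f) \<in> ?B" for u f
    unfolding b by (rule op_norm_bound(2)[OF linB _ that, where K = K]) (rule K)
  have D0B_le: "l2_norm \<mu> M f \<le> a * l2_norm \<mu> M u" if "(u, f) \<in> ?B O D0" for u f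
    unfolding a by (rule op_norm_bound(2)[OF linBD0 _ that, where K = "\<bar>K0\<bar> * K"]) (rule KK0)
  have b0: "0 \<le> b" unfolding b by (rule op_norm_bound(1)[OF linB, where K = K]) (rule K)
  \<comment> \<open>On a null space \<open>a = b = 0\<close> and both inequalities are trivial for
    the substitute \<open>\<beta>'\<close>; otherwise \<open>\<beta>' = \<beta>\<close> and the
    hypotheses on \<open>t\<close> and \<open>c\<close> apply.\<close>
  have t': "2 * (a * b) \<le> t * \<beta>'" and c': "2 * b \<le> c * \<beta>'"
    using \<beta>' t c ab_null by auto
  define \<delta> where "\<delta> = \<bar>Im l\<bar> - \<bar>Re l\<bar> * tan \<omega>"
  have "t \<le> \<delta>" using l by (simp add: sector_def \<delta>_def)
  then have \<delta>: "0 < \<delta>" "2 * (a * b) \<le> \<delta> * \<beta>'"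
    using t(1) order_trans[OF t' mult_right_mono[of t \<delta> \<beta>']] \<beta>'(1) by auto
  interpret P: perturbed_operator scale "L2 \<mu> M" "l2_inner \<mu> M" D1 ?B D0 a b \<beta>' "tan \<omega>" \<delta> l
    rewrites "semi_inner.nrm (l2_inner \<mu> M) = l2_norm \<mu> M"
  proof -
    show "perturbed_operator scale (L2 \<mu> M) (l2_inner \<mu> M) D1 ?B D0 a b \<beta>' (tan \<omega>) \<delta> l"
    proof (intro perturbed_operator.intro L2_hilbert.semi_hilbert_axioms
        perturbed_operator_axioms.intro, unfold nrm_L2)
      show "L2_inner.adj \<mu> M D1 = D1" using D1 by (simp add: adj_eq_adjoint_op self_adjoint_def)
      show "Domain D0 = L2 \<mu> M" using D0 by (simp add: bounded_operator_def)
    next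
      fix u f g assume *: "(u, f) \<in> ?B" "g \<in> L2 \<mu> M" "l2_norm \<mu> M (f - g) = 0"
      then have "u \<in> L2 \<mu> M" "f \<in> L2 \<mu> M" using L2_inner.lin_rel_V[OF linB] by blast+
      then show "(u, g) \<in> ?B"
        using * ae_eq_iff_l2_norm[of f \<mu> M g] mult_op_cong[OF *(1) _ *(2)] by (simp add: ae_eq_def)
    next
      fix u f assume "(u, f) \<in> ?B"
      then show "l2_norm \<mu> M f \<le> b * l2_norm \<mu> M u" by (rule B_le)
    next
      fix u f assume "(u, f) \<in> ?B O D0"
      then show "l2_norm \<mu> M f \<le> a * l2_norm \<mu> M u" by (rule D0B_le)
    qed (fact linD1 linB linD0 mult_op_total_bounded(1)[OF B] D0_bounded mult_op_accretive[OF sec]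
        b0 \<beta>'(1,2) \<delta>_def \<delta>)+
  qed (rule nrm_L2)
  have T_iff: "(u, f) \<in> ?T \<longleftrightarrow> (\<exists>w g h. (u, w) \<in> ?B \<and> (w, g) \<in> D1 \<and> (w, h) \<in> D0 \<and> f = g + h)" for u f
    unfolding D(2) op_add_def by blast
  have bd: "l2_norm \<mu> M u \<le> c / \<delta> * l2_norm \<mu> M (scale l u - f)" if "(u, f) \<in> ?T" for u f
  proof -
    obtain w g h where w: "(u, w) \<in> ?B" "(w, g) \<in> D1" "(w, h) \<in> D0" "f = g + h"
      using \<open>(u, f) \<in> ?T\<close> unfolding T_iff by blast
    have "scale l u - f \<in> L2 \<mu> M"
      using L2_inner.lin_rel_V[OF linT \<open>(u, f) \<in> ?T\<close>] by (intro L2_inner.V_diff L2_inner.V_scale)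
    then have F: "0 \<le> l2_norm \<mu> M (scale l u - f)" by (rule L2_inner.nrm_nonneg)
    have "\<delta> * \<beta>' * l2_norm \<mu> M u \<le> 2 * b * l2_norm \<mu> M (scale l u - f)"
      using P.resolvent_bound[OF w(1-3)] by (simp add: w(4) diff_diff_eq)
    also have "\<dots> \<le> c * \<beta>' * l2_norm \<mu> M (scale l u - f)" using c' F by (rule mult_right_mono)
    finally have "\<beta>' * (\<delta> * l2_norm \<mu> M u) \<le> \<beta>' * (c * l2_norm \<mu> M (scale l u - f))"
      by (simp add: mult_ac)
    then have "\<delta> * l2_norm \<mu> M u \<le> c * l2_norm \<mu> M (scale l u - f)"
      using \<beta>'(1) by simp
    then show ?thesis using \<delta>(1) by (simp add: pos_le_divide_eq mult.commute)
  qed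
  have cong: "(v, g) \<in> ?T"
    if "(u, f) \<in> ?T" "v \<in> L2 \<mu> M" "g \<in> L2 \<mu> M" "ae_eq \<mu> M u v" "ae_eq \<mu> M f g" for u f v g
  proof -
    obtain w where w: "(u, w) \<in> ?B" "(w, f) \<in> D" using \<open>(u, f) \<in> ?T\<close> by blast
    then have wV: "w \<in> L2 \<mu> M" using L2_inner.lin_rel_V(2)[OF linB] by blast
    have refl: "ae_eq \<mu> M w w" by (simp add: ae_eq_def)
    have "(v, w) \<in> ?B" by (rule mult_op_cong[OF w(1) that(2) wV that(4) refl])
    moreover have "(w, g) \<in> D"
      using D(1) w(2) wV that(3,5) refl unfolding operator_in_def by blast
    ultimately show ?thesis by blast
  qed
  have surj: "\<exists>u f. (u, f) \<in> ?T \<and> l2_norm \<mu> M (scale l u - f - F) = 0" if "F \<in> L2 \<mu> M" for F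
  proof -
    obtain u w g h where "(u, w) \<in> ?B" "(w, g) \<in> D1" "(w, h) \<in> D0"
      "l2_norm \<mu> M (scale l u - g - h - F) = 0"
      using P.resolvent_surj[OF \<open>F \<in> L2 \<mu> M\<close>] by blast
    then have "(u, g + h) \<in> ?T" "l2_norm \<mu> M (scale l u - (g + h) - F) = 0"
      unfolding T_iff by (blast, simp add: diff_diff_eq)
    then show ?thesis by blast
  qed
  show "l \<in> resolvent_set \<mu> M (L2 \<mu> M) ?T"
    unfolding resolvent_set_def mem_Collect_eq
    by (rule bounded_operator_resolvent[OF linT, where K = "c / \<delta>"]) (fact cong surj bd)+
  note dist = infdist_closed_sector[OF \<beta>'(2) \<delta>_def \<delta>(1)]
  have "op_norm \<mu> M (resolvent l ?T) \<le> c / \<delta>"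
  proof (rule op_norm_le)
    show "(0, 0) \<in> resolvent l ?T"
      using L2_inner.lin_rel_0[OF linT] by (simp add: resolvent_iff L2_inner.scale_zero_right)
    show "0 \<le> c / \<delta>" using c \<delta> by simp
  next
    fix F u assume "(F, u) \<in> resolvent l ?T"
    then show "l2_norm \<mu> M u \<le> c / \<delta> * l2_norm \<mu> M F" using bd by (auto simp: resolvent_def)
  qed
  also have "\<dots> \<le> c / infdist l (closed_sector \<omega>)"
    using dist c \<delta> by (intro divide_left_mono) auto
  finally show "op_norm \<mu> M (resolvent l ?T) \<le> c / infdist l (closed_sector \<omega>)" .
qed

text \<open>Used with \<open>a * b\<close> for the width of the strip and with \<open>b\<close> for
  the resolvent constant. The modulus and the summand 1 keep the constants positive for all real
  arguments, including \<open>\<beta> = 0\<close>, where the quotient is 0.\<close>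

lemma two_mult_le_abs_divide:
  "\<beta> > 0 \<Longrightarrow> 2 * x \<le> (2 * \<bar>x / \<beta>\<bar> + 1) * (\<beta> :: real)"
proof -
  assume "\<beta> > 0"
  have "2 * x \<le> 2 * \<bar>x\<bar>" by simp
  also have "\<dots> = 2 * \<bar>x / \<beta>\<bar> * \<beta>" using \<open>\<beta> > 0\<close> by (simp add: abs_divide)
  also have "\<dots> \<le> (2 * \<bar>x / \<beta>\<bar> + 1) * \<beta>" using \<open>\<beta> > 0\<close> by (simp add: distrib_right)
  finally show ?thesis .
qed

theorem proposition3p4:
  shows "\<exists>(\<tau> :: real \<Rightarrow> real \<Rightarrow> real \<Rightarrow> real) (C :: real \<Rightarrow> real \<Rightarrow> real \<Rightarrow> real).
    (\<forall>a b c. \<tau> a b c > 0 \<and> C a b c > 0) \<and>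
    (\<forall>(n::nat) (M::nat) (\<Omega> :: point set) (\<mu> :: point measure) (B :: point \<Rightarrow> cmat)
       (D :: operator) (D\<^sub>1 :: operator) (D\<^sub>0 :: operator) (\<beta> :: real) (\<omega> :: real)
       (DB :: operator) (t :: real) (c :: real).
       n \<ge> 1 \<longrightarrow> M \<ge> 1 \<longrightarrow>
       weakly_lipschitz_domain n \<Omega> \<longrightarrow>
       \<mu> = lebesgue_dom n \<Omega> \<longrightarrow>
       L_infty_matrix \<mu> M B \<longrightarrow>
       accretivity_const \<mu> M B > 0 \<longrightarrow>
       \<beta> = real_of_ereal (accretivity_const \<mu> M B) \<longrightarrow>
       \<omega> = real_of_ereal (accretivity_angle \<mu> M B) \<longrightarrow>
       operator_in \<mu> M (L2 \<mu> M) D \<longrightarrow>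
       l2_closed \<mu> M (Range D) \<longrightarrow>
       D = op_add D\<^sub>1 D\<^sub>0 \<longrightarrow>
       bounded_operator \<mu> M (L2 \<mu> M) D\<^sub>0 \<longrightarrow>
       self_adjoint \<mu> M D\<^sub>1 \<longrightarrow>
       homogeneous_first_order n M \<Omega> D\<^sub>1 \<longrightarrow>
       local_boundary_conditions n D\<^sub>1 \<longrightarrow>
       (\<exists>l \<in> resolvent_set \<mu> M (Range D) (restrict_to_range D).
          compact_operator \<mu> M (Range D) (resolvent l (restrict_to_range D))) \<longrightarrow>
       DB = mult_op \<mu> M B O D \<longrightarrow>
       t = \<tau> (op_norm \<mu> M (mult_op \<mu> M B O D\<^sub>0)) (op_norm \<mu> M (mult_op \<mu> M B)) \<beta> \<longrightarrow>
       c = C (op_norm \<mu> M (mult_op \<mu> M B O D\<^sub>0)) (op_norm \<mu> M (mult_op \<mu> M B)) \<beta> \<longrightarrow>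
       spectrum \<mu> M (L2 \<mu> M) DB \<subseteq> sector \<omega> t \<and>
       (\<forall>l. l \<notin> sector \<omega> t \<longrightarrow>
          op_norm \<mu> M (resolvent l DB) \<le> c / infdist l (closed_sector \<omega>)))"
proof (intro exI conjI)
  \<comment> \<open>Both functions are fixed before \<open>n\<close>, \<open>M\<close> and the
    domain are introduced, which expresses that the constants depend only on the two norms and
    \<open>\<beta>\<close>.\<close>
  let ?\<tau> = "\<lambda>a b \<beta> :: real. 2 * \<bar>a * b / \<beta>\<bar> + 1" and ?C = "\<lambda>a b \<beta> :: real. 2 * \<bar>b / \<beta>\<bar> + 1"
  show "\<forall>a b c. ?\<tau> a b c > 0 \<and> ?C a b c > 0"
    by (intro allI conjI add_nonneg_pos) auto
  then have pos: "?\<tau> a b c > 0" "?C a b c > 0" for a b c by blast+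
  show "\<forall>(n::nat) (M::nat) (\<Omega> :: point set) (\<mu> :: point measure) (B :: point \<Rightarrow> cmat)
       (D :: operator) (D\<^sub>1 :: operator) (D\<^sub>0 :: operator) (\<beta> :: real) (\<omega> :: real)
       (DB :: operator) (t :: real) (c :: real).
       n \<ge> 1 \<longrightarrow> M \<ge> 1 \<longrightarrow>
       weakly_lipschitz_domain n \<Omega> \<longrightarrow>
       \<mu> = lebesgue_dom n \<Omega> \<longrightarrow>
       L_infty_matrix \<mu> M B \<longrightarrow>
       accretivity_const \<mu> M B > 0 \<longrightarrow>
       \<beta> = real_of_ereal (accretivity_const \<mu> M B) \<longrightarrow>
       \<omega> = real_of_ereal (accretivity_angle \<mu> M B) \<longrightarrow>
       operator_in \<mu> M (L2 \<mu> M) D \<longrightarrow>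
       l2_closed \<mu> M (Range D) \<longrightarrow>
       D = op_add D\<^sub>1 D\<^sub>0 \<longrightarrow>
       bounded_operator \<mu> M (L2 \<mu> M) D\<^sub>0 \<longrightarrow>
       self_adjoint \<mu> M D\<^sub>1 \<longrightarrow>
       homogeneous_first_order n M \<Omega> D\<^sub>1 \<longrightarrow>
       local_boundary_conditions n D\<^sub>1 \<longrightarrow>
       (\<exists>l \<in> resolvent_set \<mu> M (Range D) (restrict_to_range D).
          compact_operator \<mu> M (Range D) (resolvent l (restrict_to_range D))) \<longrightarrow>
       DB = mult_op \<mu> M B O D \<longrightarrow>
       t = ?\<tau> (op_norm \<mu> M (mult_op \<mu> M B O D\<^sub>0)) (op_norm \<mu> M (mult_op \<mu> M B)) \<beta> \<longrightarrow>
       c = ?C (op_norm \<mu> M (mult_op \<mu> M B O D\<^sub>0)) (op_norm \<mu> M (mult_op \<mu> M B)) \<beta> \<longrightarrow>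
       spectrum \<mu> M (L2 \<mu> M) DB \<subseteq> sector \<omega> t \<and>
       (\<forall>l. l \<notin> sector \<omega> t \<longrightarrow>
          op_norm \<mu> M (resolvent l DB) \<le> c / infdist l (closed_sector \<omega>))"
  proof (intro allI impI)
    fix n M :: nat and \<Omega> \<mu> and B :: "point \<Rightarrow> cmat" and D D1 D0 DB :: operator and \<beta> \<omega> t c :: real
    assume M: "1 \<le> M" and B: "L_infty_matrix \<mu> M B" "accretivity_const \<mu> M B > 0"
      "\<beta> = real_of_ereal (accretivity_const \<mu> M B)" "\<omega> = real_of_ereal (accretivity_angle \<mu> M B)"
      and D: "operator_in \<mu> M (L2 \<mu> M) D" "D = op_add D1 D0"
        "bounded_operator \<mu> M (L2 \<mu> M) D0" "self_adjoint \<mu> M D1"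
      and DB: "DB = mult_op \<mu> M B O D"
      and t: "t = ?\<tau> (op_norm \<mu> M (mult_op \<mu> M B O D0)) (op_norm \<mu> M (mult_op \<mu> M B)) \<beta>"
      and c: "c = ?C (op_norm \<mu> M (mult_op \<mu> M B O D0)) (op_norm \<mu> M (mult_op \<mu> M B)) \<beta>"
    note * = resolvent_mult_op_comp[OF M B D refl refl pos(1) two_mult_le_abs_divide pos(2) two_mult_le_abs_divide, folded t c DB]
    show "spectrum \<mu> M (L2 \<mu> M) DB \<subseteq> sector \<omega> t \<and>
       (\<forall>l. l \<notin> sector \<omega> t \<longrightarrow>
          op_norm \<mu> M (resolvent l DB) \<le> c / infdist l (closed_sector \<omega>))"
      using * unfolding spectrum_def by blast
  qed
qed

end
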